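(* Let $\varphi:S^1\to S^1$ be an orientation preserving homeomorphism with irrational rotation number $\varrho\in(0,1)$ and let $\mu$ be its unique normalized invariant ergodic measure. (1) If $\varphi$ is transitive, then the displacement distribution $\mu_\Psi$ is the transported measure $$\mu_\Psi(A):=\mu(\{x\in[0,1):\Psi(x)\in A\})=\Lambda(\Omega^{-1}(A)),\qquad \Omega(x):=\Gamma^{-1}(x+\varrho)-\Gamma^{-1}(x),$$ for every Borel set $A\subset[0,1)$, and its support equals $\mathrm{supp}(\mu_\Psi)=\Psi([0,1])=\Omega([0,1])$. (2) If $\varphi$ is not transitive, then $$\mu_\Psi(A)=\Lambda(\widehat\Omega^{-1}(A)),\qquad \widehat\Omega(x):=\widehat\Gamma^{-1}(x+\varrho)-\widehat\Gamma^{-1}(x),$$ for every Borel set $A\subset[0,1)$, and $\mathrm{supp}(\mu_\Psi)=\Psi(\widetilde\Delta_0)$.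
   Context: $S^1$ is covered by $\mathbb{R}$ via $x\mapsto\exp(2\pi\mathrm{i}x)$; measures on $S^1$ are identified with measures on $[0,1)$, and $\Lambda$ is normalized Lebesgue measure. $\Phi:\mathbb{R}\to\mathbb{R}$ is the lift of $\varphi$ with $\Phi(0)\in(0,1)$, and $\Psi(x)=\Phi(x)-x$ is the displacement function. $\mu$ is the unique $\varphi$-invariant Borel probability measure; it is non-atomic and given by $\mu(A)=\Lambda(\gamma(A))$, where $\gamma:S^1\to S^1$ is the continuous non-decreasing surjective map with $\gamma\circ\varphi=r_\varrho\circ\gamma$ and $r_\varrho(z)=z\exp(2\pi\mathrm{i}\varrho)$. $\Gamma:\mathbb{R}\to\mathbb{R}$ is the lift of $\gamma$ with $\Gamma(x)=\mu([0,x])$ for $x\in[0,1)$, $\Gamma(x+1)=\Gamma(x)+1$, $\Gamma(\Phi(x))=\Gamma(x)+\varrho$. If $\varphi$ is transitive, $\Gamma$ is a homeomorphism. If $\varphi$ is not transitive, $\Delta\subset S^1$ is its unique minimal set (a Cantor type set), $\widetilde\Delta_0\subset[0,1)$ is the lift of $\Delta$ to $[0,1)$, and $\gamma$ is 1-to-1 on $\Delta$ except on a countable set $E\subset\Delta$ (the points of $\Delta$ at which injectivity of $\gamma|_\Delta$ fails, i.e. the end-points of the complementary intervals), with $\mu(E)=0$. $\widehat\Delta$ is the lift of $\Delta\setminus E$ to $[0,1)$, and $\widehat\Gamma=\Gamma\upharpoonright_{\widehat\Delta}$. As usual "mod 1" is suppressed: $\widehat\Gamma$ is understood to be extended to $\widehat\Delta+\mathbb{Z}$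 by $\widehat\Gamma(x+1)=\widehat\Gamma(x)+1$ in the expression $\widehat\Gamma^{-1}(x+\varrho)$, so that $\widehat\Omega$ is defined on $\widehat\Gamma(\widehat\Delta)$, i.e. for all but countably many $x\in[0,1)$. *)

theory Defs
  imports "HOL-Probability.Probability"
begin

abbreviation S1 :: "complex set" where
  "S1 \<equiv> sphere 0 1"

definition covering :: "real \<Rightarrow> complex" where
  "covering x = exp (2 * of_real pi * \<i> * of_real x)"

text \<open>The inverse of the bijection \<open>covering : [0,1) \<rightarrow> S1\<close>; \<^const>\<open>Arg2pi\<close> has values in
  \<open>[0, 2 pi)\<close>.\<close>

definition unit_coord :: "complex \<Rightarrow> real" where
  "unit_coord z = Arg2pi z / (2 * pi)"

definition circle_lift :: "(complex \<Rightarrow> complex) \<Rightarrow> (real \<Rightarrow> real) \<Rightarrow> bool" where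
  "circle_lift f F \<longleftrightarrow> continuous_on UNIV F \<and> (\<forall>x. covering (F x) = f (covering x))"

definition lift_set :: "complex set \<Rightarrow> real set" where
  "lift_set D = {x \<in> {0..<1}. covering x \<in> D}"

definition orientation_preserving_homeo :: "(complex \<Rightarrow> complex) \<Rightarrow> bool" where
  "orientation_preserving_homeo f \<longleftrightarrow>
     (\<exists>g. homeomorphism S1 S1 f g) \<and> (\<exists>F. circle_lift f F \<and> strict_mono F)"

text \<open>The rotation number is the limit of \<open>F\<^sup>n(x)/n\<close> modulo 1, with its representative taken
  in \<open>[0,1)\<close>. For orientation preserving homeomorphisms the limit exists, is independent of
  \<open>x\<close>, and changes by an integer with the choice of the lift \<open>F\<close>.\<close>

definition has_rotation_number :: "(complex \<Rightarrow> complex) \<Rightarrow> real \<Rightarrow> bool" where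
  "has_rotation_number f r \<longleftrightarrow> 0 \<le> r \<and> r < 1 \<and>
     (\<exists>F. circle_lift f F \<and>
       (\<exists>k::int. \<forall>x. (\<lambda>n. (F ^^ n) x / real n) \<longlonglongrightarrow> r + of_int k))"

definition transitive_on_circle :: "(complex \<Rightarrow> complex) \<Rightarrow> bool" where
  "transitive_on_circle f \<longleftrightarrow> (\<exists>z\<in>S1. S1 \<subseteq> closure (range (\<lambda>n. (f ^^ n) z)))"

definition minimal_set :: "(complex \<Rightarrow> complex) \<Rightarrow> complex set \<Rightarrow> bool" where
  "minimal_set f D \<longleftrightarrow> D \<subseteq> S1 \<and> D \<noteq> {} \<and> closed D \<and> f ` D \<subseteq> D \<and>
     (\<forall>K. K \<subseteq> D \<and> K \<noteq> {} \<and> closed K \<and> f ` K \<subseteq> K \<longrightarrow> K = D)"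

definition invariant_probability :: "(complex \<Rightarrow> complex) \<Rightarrow> complex measure \<Rightarrow> bool" where
  "invariant_probability f \<mu> \<longleftrightarrow>
     prob_space \<mu> \<and> sets \<mu> = sets (restrict_space borel S1) \<and>
     (\<forall>A\<in>sets \<mu>. emeasure \<mu> (f -` A \<inter> space \<mu>) = emeasure \<mu> A)"

definition ergodic_measure :: "(complex \<Rightarrow> complex) \<Rightarrow> complex measure \<Rightarrow> bool" where
  "ergodic_measure f \<mu> \<longleftrightarrow>
     (\<forall>A\<in>sets \<mu>. f -` A \<inter> space \<mu> = A \<longrightarrow> emeasure \<mu> A = 0 \<or> emeasure \<mu> A = 1)"

text \<open>The identification of measures on the circle with measures on \<open>[0,1)\<close>.\<close>

definition interval_measure_of :: "complex measure \<Rightarrow> real measure" where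
  "interval_measure_of \<mu> = distr \<mu> (restrict_space borel {0..<1}) unit_coord"

definition measure_support :: "real measure \<Rightarrow> real set" where
  "measure_support M = {x. \<forall>U. open U \<and> x \<in> U \<longrightarrow> emeasure M U > 0}"

definition displacement :: "(real \<Rightarrow> real) \<Rightarrow> real \<Rightarrow> real" where
  "displacement F x = F x - x"

text \<open>As the base measure lives on \<open>[0,1)\<close>, the value on a Borel set \<open>A\<close> is the measure of
  \<open>{x \<in> [0,1). F x - x \<in> A}\<close>.\<close>

definition displacement_distribution :: "complex measure \<Rightarrow> (real \<Rightarrow> real) \<Rightarrow> real measure" where
  "displacement_distribution \<mu> F = distr (interval_measure_of \<mu>) borel (displacement F)"

text \<open>The distribution function \<open>x \<mapsto> \<mu>([0,x])\<close> on \<open>[0,1)\<close>, extended to the real line by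
  \<open>\<Gamma>(x+1) = \<Gamma>(x)+1\<close>, and the circle map with this lift.\<close>

definition Gamma_lift :: "complex measure \<Rightarrow> real \<Rightarrow> real" where
  "Gamma_lift \<mu> x = of_int \<lfloor>x\<rfloor> + measure (interval_measure_of \<mu>) {0..frac x}"

definition gamma_circle :: "complex measure \<Rightarrow> complex \<Rightarrow> complex" where
  "gamma_circle \<mu> z = covering (Gamma_lift \<mu> (unit_coord z))"

definition Omega :: "complex measure \<Rightarrow> real \<Rightarrow> real \<Rightarrow> real" where
  "Omega \<mu> r x = inv (Gamma_lift \<mu>) (x + r) - inv (Gamma_lift \<mu>) x"

definition noninjective_points :: "complex measure \<Rightarrow> complex set \<Rightarrow> complex set" where
  "noninjective_points \<mu> D =
     {z \<in> D. \<exists>w\<in>D. w \<noteq> z \<and> gamma_circle \<mu> w = gamma_circle \<mu> z}"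

definition Delta_hat :: "complex measure \<Rightarrow> complex set \<Rightarrow> real set" where
  "Delta_hat \<mu> D = lift_set (D - noninjective_points \<mu> D)"

text \<open>The inverse of the restriction of \<^const>\<open>Gamma_lift\<close> to the 1-periodic set
  \<open>Delta_hat \<mu> D + \<int>\<close>.\<close>

definition Gamma_hat_inv :: "complex measure \<Rightarrow> complex set \<Rightarrow> real \<Rightarrow> real" where
  "Gamma_hat_inv \<mu> D =
     inv_into {x + of_int k |x k. x \<in> Delta_hat \<mu> D} (Gamma_lift \<mu>)"

text \<open>Meaningful on \<open>Gamma_lift \<mu> ` Delta_hat \<mu> D\<close> only.\<close>

definition Omega_hat :: "complex measure \<Rightarrow> complex set \<Rightarrow> real \<Rightarrow> real \<Rightarrow> real" where
  "Omega_hat \<mu> D r x = Gamma_hat_inv \<mu> D (x + r) - Gamma_hat_inv \<mu> D x"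

end

theory Submission
  imports Defs
begin

text \<open>
  Let \<open>G\<close> be the distribution function \<^const>\<open>Gamma_lift\<close> of the invariant measure. The
  \<open>\<mu>\<close>-measure of an arc is the increment of \<open>G\<close> over a lift of the arc, so invariance of \<open>\<mu>\<close>
  says that \<open>G (\<Phi> b) - G (\<Phi> a) = G b - G a\<close>, that is, \<open>G \<circ> \<Phi> = G + c\<close> for a constant
  \<open>c\<close> (\<open>Gamma_lift_semiconjugacy\<close>). Since \<open>G\<close> stays within distance \<open>1\<close> of the identity,
  \<open>\<Phi>\<close> and the translation by \<open>c\<close> have the same mean speed, and the normalisations of
  \<open>\<Phi> 0\<close> and \<open>\<rho>\<close> leave only \<open>c = \<rho>\<close> (\<open>Gamma_lift_rotation\<close>).

  Everything else follows from this semiconjugacy and the density of \<open>{n\<rho> + j}\<close>. The monotone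
  function \<open>G\<close> has a dense set of values, hence it is continuous: this is the absence of
  atoms. A continuous distribution function pushes its measure to
  Lebesgue measure (\<open>emeasure_vimage_G\<close>). The values that \<open>G\<close> takes more than once are
  countably many, because each of their fibres contains a rational; therefore almost every point
  is the only point in its fibre. If \<open>x\<close> is such a point then so is \<open>\<Phi> x\<close>, and inverting \<open>G\<close>
  at \<open>G x\<close> and at \<open>G x + \<rho> = G (\<Phi> x)\<close> gives \<open>\<Phi> x - x\<close>: the displacement is the map
  \<open>\<Omega>\<close> (or its partially defined version) composed with \<open>G\<close>. This yields the transport formula.

  The support is the image under the displacement of the set of points such that \<open>G\<close> grows on
  each of their neighbourhoods. These neighbourhoods have positive measure, and the set has full
  measure since it contains the points that are alone in their fibre
  (\<open>support_displacement_distribution\<close>).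

  It remains to describe the two sets of points of the line in dynamical terms. In the transitive
  case a plateau of \<open>G\<close> would be visited by the dense orbit at two different times \<open>n\<close> and
  \<open>n'\<close>, making \<open>(n - n')\<rho>\<close> an integer; so \<open>G\<close> is strictly increasing and both sets are the
  whole line (\<open>transitive_imp_strict_mono\<close>). In general any orbit enters every interval on
  which \<open>G\<close> grows, so a closed forward invariant set contains all growth points; these form a
  closed invariant set themselves, and hence they are the lift of every minimal set
  (\<open>minimal_set_lift\<close>). As a fibre of \<open>G\<close> is an interval with end points in the growth set, a
  point of the minimal set is alone in its fibre exactly if no other point of the minimal set has
  the same image (\<open>injectivity_points_iff_growth\<close>), and this identifies \<^const>\<open>Delta_hat\<close>.
\<close>

section \<open>The covering of the circle\<close>

lemma covering_eq_iff: "covering x = covering y \<longleftrightarrow> (\<exists>k::int. x = y + of_int k)"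
proof -
  have "covering x = covering y \<longleftrightarrow>
      (\<exists>k::int. 2 * of_real pi * \<i> * of_real x
        = 2 * of_real pi * \<i> * of_real y + of_int (2 * k) * of_real pi * \<i>)"
    unfolding covering_def exp_eq by simp
  also have "\<dots> \<longleftrightarrow> (\<exists>k::int. x = y + of_int k)"
  proof (rule ex_cong1)
    fix k :: int
    have "2 * of_real pi * \<i> * of_real y + of_int (2 * k) * of_real pi * \<i>
        = 2 * of_real pi * \<i> * of_real (y + of_int k)"
      by (simp add: algebra_simps)
    then show "2 * of_real pi * \<i> * of_real x
          = 2 * of_real pi * \<i> * of_real y + of_int (2 * k) * of_real pi * \<i> \<longleftrightarrow>
        x = y + of_int k"
      by (simp only: mult_cancel_left of_real_eq_iff) simp
  qed
  finally show ?thesis .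
qed

lemma covering_add_of_int [simp]: "covering (x + of_int k) = covering x"
  by (auto simp: covering_eq_iff)

lemma covering_in_S1 [simp]: "covering x \<in> S1"
proof -
  have "covering x = exp (\<i> * of_real (2 * pi * x))"
    by (simp add: covering_def mult_ac)
  then show ?thesis by (simp only: mem_sphere dist_0_norm norm_exp_i_times)
qed

lemma norm_covering [simp]: "norm (covering x) = 1"
  using covering_in_S1[of x] by (simp del: covering_in_S1)

lemma continuous_on_covering: "continuous_on A covering"
  unfolding covering_def by (intro continuous_intros)

lemma unit_coord_bounds: "0 \<le> unit_coord z" "unit_coord z < 1"
  using Arg2pi[of z] by (auto simp: unit_coord_def)

lemma covering_unit_coord [simp]: "norm z = 1 \<Longrightarrow> covering (unit_coord z) = z"
  using complex_norm_eq_1_exp[of z]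
  by (simp add: covering_def unit_coord_def mult_ac)

lemma unit_coord_covering: "unit_coord (covering x) = frac x"
proof -
  have "covering (unit_coord (covering x)) = covering x" by simp
  then obtain k :: int where k: "unit_coord (covering x) = x + of_int k"
    unfolding covering_eq_iff by blast
  then have "frac (unit_coord (covering x)) = frac x" by simp
  then show ?thesis using unit_coord_bounds[of "covering x"] frac_eq[of "unit_coord (covering x)"]
    by simp
qed

lemma borel_measurable_unit_coord: "unit_coord \<in> borel_measurable borel"
proof -
  have "Arg2pi \<in> borel_measurable borel"
    by (rule borel_measurableI_le) (simp add: borel_closed closed_Arg2pi2pi_le)
  then show ?thesis unfolding unit_coord_def by simp
qed

text \<open>The covering is open: the complement on the circle of the image of a short open interval is
  the image of a compact interval. Hence a set accumulating at \<open>covering y\<close> has lifts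
  near \<open>y\<close>.\<close>

lemma closure_circle_lift:
  assumes w: "covering y \<in> closure D" and D: "D \<subseteq> S1" and ab: "a < y" "y < b"
  shows "\<exists>x. a < x \<and> x < b \<and> covering x \<in> D"
proof -
  define a' b' where "a' = max a (y - 1/2)" and "b' = min b (y + 1/2)"
  have ab': "a \<le> a'" "a' < y" "y < b'" "b' \<le> b" "b' \<le> a' + 1"
    using ab by (auto simp: a'_def b'_def)
  define K where "K = covering ` {b'..a'+1}"
  have "compact K"
    unfolding K_def by (intro compact_continuous_image continuous_on_covering compact_Icc)
  then have "open (- K)" by (simp add: compact_imp_closed open_Compl)
  moreover have "covering y \<notin> K"
  proof
    assume "covering y \<in> K"
    then obtain k :: int where k: "b' \<le> y + of_int k" "y + of_int k \<le> a' + 1"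
      unfolding K_def by (metis (no_types, lifting) atLeastAtMost_iff covering_eq_iff imageE)
    have "of_int k < (1::real)" "(0::real) < of_int k" using k ab' by linarith+
    then show False by simp
  qed
  ultimately have "- K \<inter> D \<noteq> {}"
    using w open_Int_closure_eq_empty by blast
  then obtain u where u: "u \<in> D" "u \<notin> K" by blast
  \<comment> \<open>The lift of \<open>u\<close> in the fundamental domain \<open>(a', a' + 1]\<close>.\<close>
  define x where "x = a' + 1 - frac (a' + 1 - unit_coord u)"
  have "x = unit_coord u + of_int \<lfloor>a' + 1 - unit_coord u\<rfloor>" by (simp add: x_def frac_def)
  then have "covering x = u" using u D by auto
  moreover have "a' < x" "x \<le> a' + 1" 
    using frac_lt_1[of "a' + 1 - unit_coord u"] frac_ge_0[of "a' + 1 - unit_coord u"]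
    by (auto simp: x_def)
  moreover from this have "x < b'"
    using u \<open>covering x = u\<close> by (force simp: K_def)
  ultimately show ?thesis using u ab' by (intro exI[of _ x]) auto
qed

section \<open>Maps of degree one\<close>

locale degree_one =
  fixes G :: "real \<Rightarrow> real"
  assumes add_1: "G (x + 1) = G x + 1"
begin

lemma add_of_nat: "G (x + of_nat n) = G x + of_nat n"
proof (induction n)
  case (Suc n)
  have "G (x + of_nat (Suc n)) = G ((x + of_nat n) + 1)" by (simp add: algebra_simps)
  then show ?case using Suc add_1[of "x + of_nat n"] by simp
qed simp

lemma add_of_int: "G (x + of_int k) = G x + of_int k"
proof (cases "k \<ge> 0")
  case True
  then show ?thesis using add_of_nat[of x "nat k"] by simp
next
  case False
  then show ?thesis using add_of_nat[of "x + of_int k" "nat (- k)"] by simp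
qed

text \<open>The values at integers march through the line in unit steps, so the intermediate value
  theorem reaches everything.\<close>

lemma continuous_surj:
  assumes cont: "continuous_on UNIV G"
  shows "surj G"
proof -
  have "\<exists>x. G x = t" for t
  proof -
    define n where "n = \<lfloor>t - G 0\<rfloor>"
    have "G (0 + of_int n) \<le> t" "t \<le> G (0 + of_int (n + 1))"
      unfolding add_of_int n_def by linarith+
    then show ?thesis
      using IVT'[of G "of_int n" t "of_int (n + 1)"] continuous_on_subset[OF cont] by fastforce
  qed
  then show ?thesis unfolding surj_def by metis
qed

end

locale monotone_degree_one = degree_one +
  assumes mono: "mono G" and cont: "continuous_on UNIV G"
begin

text \<open>The right end of the fibre over \<open>t\<close>. This right inverse is defined everywhere and monotone,
  hence Borel, which makes images under \<open>G\<close> measurable later on.\<close>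

definition upper_inverse :: "real \<Rightarrow> real" where
  "upper_inverse t = Sup {x. G x \<le> t}"

lemma attained: obtains y where "G y = t"
  using continuous_surj[OF cont] by (metis surjD)

lemma less_imp_less: "G x < G y \<Longrightarrow> x < y"
  using mono by (meson monoD not_le)

lemma G_upper_inverse [simp]: "G (upper_inverse t) = t"
  and le_upper_inverse: "G x \<le> t \<Longrightarrow> x \<le> upper_inverse t"
proof -
  obtain y where y: "G y = t" by (rule attained)
  have bdd: "bdd_above {x. G x \<le> t}"
  proof (rule bdd_aboveI)
    fix x assume "x \<in> {x. G x \<le> t}"
    then have "G x < G (y + 1)" using y add_1[of y] by simp
    then show "x \<le> y + 1" using less_imp_less by force
  qed
  show le: "x \<le> upper_inverse t" if "G x \<le> t" for x
    unfolding upper_inverse_def using that bdd by (intro cSup_upper) auto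
  have "closed {x. G x \<le> t}"
    by (intro closed_Collect_le cont continuous_on_const)
  then have "G (upper_inverse t) \<le> t"
    using closed_contains_Sup[of "{x. G x \<le> t}"] bdd y
    unfolding upper_inverse_def by auto
  moreover have "t \<le> G (upper_inverse t)"
    using le[of y] y mono by (metis monoD order_refl)
  ultimately show "G (upper_inverse t) = t" by simp
qed

lemma le_upper_inverse_iff: "x \<le> upper_inverse t \<longleftrightarrow> G x \<le> t"
  using le_upper_inverse G_upper_inverse mono by (metis monoD)

lemma mono_upper_inverse: "mono upper_inverse"
  by (rule monoI) (simp add: le_upper_inverse_iff)

text \<open>If \<open>G\<close> is the distribution function of a measure on the circle, these are the lifts of the
  points in the support of the measure.\<close>

definition growth_points :: "real set" where
  "growth_points = {y. \<forall>a b. a < y \<longrightarrow> y < b \<longrightarrow> G a < G b}"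

definition injectivity_points :: "real set" where
  "injectivity_points = {x. \<forall>y. G y = G x \<longrightarrow> y = x}"

definition plateau_values :: "real set" where
  "plateau_values = {t. \<exists>x y. x < y \<and> G x = t \<and> G y = t}"

lemma growth_points_add_of_int:
  "x + of_int k \<in> growth_points \<longleftrightarrow> x \<in> growth_points"
proof -
  have *: "x + of_int k \<in> growth_points" if "x \<in> growth_points" for x k
    unfolding growth_points_def
  proof (intro CollectI allI impI)
    fix a b assume "a < x + of_int k" "x + of_int k < b"
    then have "G (a + of_int (- k)) < G (b + of_int (- k))"
      using that unfolding growth_points_def by auto
    then show "G a < G b" unfolding add_of_int by simp
  qed
  show ?thesis using *[of x k] *[of "x + of_int k" "- k"] by auto
qed

lemma closed_growth_points: "closed growth_points"
  unfolding closed_def open_dist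
proof (intro ballI)
  fix y assume "y \<in> - growth_points"
  then obtain a b where ab: "a < y" "y < b" "\<not> G a < G b"
    unfolding growth_points_def by auto
  have "\<forall>z. dist z y < min (y - a) (b - y) \<longrightarrow> z \<in> - growth_points"
  proof (intro allI impI)
    fix z assume "dist z y < min (y - a) (b - y)"
    then have "a < z" "z < b" by (auto simp: dist_real_def)
    then show "z \<in> - growth_points" using ab(3) unfolding growth_points_def by blast
  qed
  then show "\<exists>e>0. \<forall>z. dist z y < e \<longrightarrow> z \<in> - growth_points"
    using ab by (intro exI[of _ "min (y - a) (b - y)"]) auto
qed

lemma upper_inverse_growth: "upper_inverse t \<in> growth_points"
  unfolding growth_points_def
proof (intro CollectI allI impI)
  fix a b assume "a < upper_inverse t" "upper_inverse t < b"
  then have "G a \<le> t" "\<not> G b \<le> t" using le_upper_inverse_iff by force+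
  then show "G a < G b" by simp
qed

text \<open>The left end of a fibre becomes a right end after the reflection \<open>x \<mapsto> - G (- x)\<close>, so
  the properties of \<open>upper_inverse\<close> apply to it.\<close>

lemma fibre_left_end_growth:
  obtains p where "p \<le> x" "G p = G x" "p \<in> growth_points"
proof -
  interpret R: monotone_degree_one "\<lambda>x. - G (- x)"
  proof
    show "- G (- (y + 1)) = - G (- y) + 1" for y
      using add_1[of "- y - 1"] by simp
    show "mono (\<lambda>x. - G (- x))" using mono by (simp add: mono_def)
    show "continuous_on UNIV (\<lambda>x. - G (- x))"
      by (intro continuous_intros continuous_on_compose2[OF cont]) auto
  qed
  define p where "p = - R.upper_inverse (- G x)"
  have "p \<le> x" unfolding p_def using R.le_upper_inverse[of "- x" "- G x"] by simp
  moreover have "G p = G x" using R.G_upper_inverse[of "- G x"] unfolding p_def by linarith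
  moreover have "p \<in> growth_points"
    unfolding growth_points_def
  proof (intro CollectI allI impI)
    fix a b assume "a < p" "p < b"
    then have "- b < R.upper_inverse (- G x)" "R.upper_inverse (- G x) < - a"
      by (auto simp: p_def)
    moreover have "\<forall>a b. a < R.upper_inverse (- G x) \<longrightarrow> R.upper_inverse (- G x) < b \<longrightarrow>
        - G (- a) < - G (- b)"
      using R.upper_inverse_growth[of "- G x"] unfolding R.growth_points_def by (rule CollectD)
    ultimately have "- G (- (- b)) < - G (- (- a))" by blast
    then show "G a < G b" by simp
  qed
  ultimately show ?thesis by (rule that)
qed

lemma injectivity_pointsD: "x \<in> injectivity_points \<Longrightarrow> G y = G x \<Longrightarrow> y = x"
  unfolding injectivity_points_def by blast

lemma injectivity_points_iff: "x \<in> injectivity_points \<longleftrightarrow> G x \<notin> plateau_values"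
proof -
  have "(\<exists>y. G y = G x \<and> y \<noteq> x) \<longleftrightarrow> G x \<in> plateau_values"
  proof
    assume "\<exists>y. G y = G x \<and> y \<noteq> x"
    then show "G x \<in> plateau_values" unfolding plateau_values_def neq_iff by blast
  next
    assume "G x \<in> plateau_values"
    then obtain y z where "y < z" "G y = G x" "G z = G x" unfolding plateau_values_def by blast
    then show "\<exists>y. G y = G x \<and> y \<noteq> x" by (metis less_irrefl)
  qed
  then show ?thesis unfolding injectivity_points_def by blast
qed

lemma upper_inverse_injectivity_point:
  "x \<in> injectivity_points \<Longrightarrow> upper_inverse (G x) = x"
  by (erule injectivity_pointsD) (rule G_upper_inverse)

lemma injectivity_points_subset_growth: "injectivity_points \<subseteq> growth_points"
proof
  fix x assume "x \<in> injectivity_points"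
  then show "x \<in> growth_points"
    using upper_inverse_growth[of "G x"] by (simp only: upper_inverse_injectivity_point)
qed

text \<open>Both ends of a fibre are growth points; if there is only one growth point in the fibre, the
  ends coincide.\<close>

lemma injectivity_points_iff_growth:
  "x \<in> injectivity_points \<longleftrightarrow>
     x \<in> growth_points \<and> (\<forall>y\<in>growth_points. G y = G x \<longrightarrow> y = x)"
proof
  assume "x \<in> injectivity_points"
  then show "x \<in> growth_points \<and> (\<forall>y\<in>growth_points. G y = G x \<longrightarrow> y = x)"
    using injectivity_points_subset_growth injectivity_pointsD by blast
next
  assume x: "x \<in> growth_points \<and> (\<forall>y\<in>growth_points. G y = G x \<longrightarrow> y = x)"
  show "x \<in> injectivity_points"
    unfolding injectivity_points_def
  proof (intro CollectI allI impI)
    fix y assume y: "G y = G x"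
    obtain p where p: "p \<le> y" "G p = G y" "p \<in> growth_points" by (rule fibre_left_end_growth)
    have "upper_inverse (G x) = x"
      using x upper_inverse_growth[of "G x"] G_upper_inverse[of "G x"] by blast
    then have "y \<le> x" using le_upper_inverse[of y "G x"] y by simp
    moreover have "p = x" using x p(2,3) unfolding y by blast
    then have "x \<le> y" using p(1) by simp
    ultimately show "y = x" by simp
  qed
qed

text \<open>Each plateau contains a rational.\<close>

lemma countable_plateau_values: "countable plateau_values"
proof -
  have "plateau_values \<subseteq> G ` \<rat>"
  proof
    fix t assume "t \<in> plateau_values"
    then obtain x y where xy: "x < y" "G x = t" "G y = t" unfolding plateau_values_def by blast
    then obtain q where q: "q \<in> \<rat>" "x < q" "q < y" using Rats_dense_in_real by blast
    then have "G x \<le> G q" "G q \<le> G y" using monoD[OF mono] by simp_all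
    then have "G q = t" using xy by simp
    then show "t \<in> G ` \<rat>" using q by blast
  qed
  then show ?thesis by (rule countable_subset) (intro countable_image countable_rat)
qed

lemma strict_mono_iff_no_plateau: "strict_mono G \<longleftrightarrow> plateau_values = {}"
proof
  assume "strict_mono G"
  have "t \<notin> plateau_values" for t
  proof
    assume "t \<in> plateau_values"
    then obtain x y where xy: "x < y" "G x = t" "G y = t" unfolding plateau_values_def by blast
    from strict_monoD[OF \<open>strict_mono G\<close> xy(1)] show False unfolding xy(2,3) by (rule less_irrefl[THEN notE])
  qed
  then show "plateau_values = {}" by (simp add: set_eq_iff)
next
  assume *: "plateau_values = {}"
  show "strict_mono G"
  proof (rule strict_monoI)
    fix x y :: real assume "x < y"
    then have "G x \<le> G y" using monoD[OF mono, of x y] by simp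
    moreover have "G x \<noteq> G y"
    proof
      assume "G x = G y"
      then have "G y \<in> plateau_values"
        using \<open>x < y\<close> unfolding plateau_values_def by (intro CollectI exI[of _ x] exI[of _ y]) simp
      then show False using * by simp
    qed
    ultimately
    show "G x < G y" by simp
  qed
qed

end

section \<open>Distribution functions on the circle\<close>

text \<open>\<open>G\<close> is the degree one extension to the line of the distribution function of a probability
  measure on \<open>[0,1)\<close>. Continuity of \<open>G\<close>, also at the integers, excludes atoms.\<close>

locale distribution_lift = monotone_degree_one G + prob_space m
  for G :: "real \<Rightarrow> real" and m :: "real measure" +
  assumes sets_m: "sets m = sets (restrict_space borel {0..<1})"
    and distribution: "\<And>x. 0 \<le> x \<Longrightarrow> x < 1 \<Longrightarrow> G x = measure m {0..x}"
begin

lemma space_m: "space m = {0..<1}"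
  using sets_eq_imp_space_eq[OF sets_m] by (simp add: space_restrict_space)

lemma measurable_m: "f \<in> borel_measurable borel \<Longrightarrow> f \<in> borel_measurable m"
  by (subst measurable_cong_sets[OF sets_m refl]) (rule measurable_restrict_space1)

lemma borel_measurable_G [measurable]: "G \<in> borel_measurable borel"
  using cont by (rule borel_measurable_continuous_onI)

text \<open>A positive \<open>G 0\<close> would be an atom at \<open>0\<close>: on \<open>[-1,0)\<close> the values of \<open>G\<close> are at most \<open>0\<close>,
  being those on \<open>[0,1)\<close> lowered by \<open>1\<close>, so \<open>G 0 / 2\<close> would not be attained.\<close>

lemma G_0 [simp]: "G 0 = 0"
proof (rule antisym)
  show "G 0 \<le> 0"
  proof (rule ccontr)
    assume pos: "\<not> G 0 \<le> 0"
    obtain y where y: "G y = G 0 / 2" by (rule attained)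
    have "y < 0" by (rule less_imp_less) (use y pos in simp)
    have "G 0 \<le> 1" using distribution[of 0] prob_le_1[of "{0..0}"] by simp
    moreover have "G (- 1) = G 0 - 1" using add_1[of "- 1"] by simp
    ultimately have "- 1 < y" by - (rule less_imp_less, use y pos in linarith)
    then have "G (y + 1) \<le> 1" using \<open>y < 0\<close> distribution[of "y + 1"] by simp
    then show False using add_1[of y] y pos by simp
  qed
  show "0 \<le> G 0" using distribution[of 0] measure_nonneg[of m "{0..0}"] by simp
qed

lemma G_1 [simp]: "G 1 = 1" using add_1[of 0] by simp

lemma G_bounds: "0 \<le> x \<Longrightarrow> 0 \<le> G x" "x \<le> 1 \<Longrightarrow> G x \<le> 1"
  using monoD[OF mono, of 0 x] monoD[OF mono, of x 1] by simp_all

text \<open>The sublevel set is the interval from \<open>0\<close> to the right end \<open>s\<close> of the fibre over \<open>t\<close>, and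
  its measure is \<open>G s = t\<close>.\<close>

lemma measure_G_le:
  assumes "0 \<le> t" "t < 1"
  shows "measure m {x \<in> space m. G x \<le> t} = t"
proof -
  have u: "0 \<le> upper_inverse t" "upper_inverse t < 1"
    using assms le_upper_inverse_iff[of 0 t] le_upper_inverse_iff[of 1 t] by simp_all
  have "{x \<in> space m. G x \<le> t} = {x \<in> {0..<1}. x \<le> upper_inverse t}"
    unfolding space_m le_upper_inverse_iff ..
  also have "\<dots> = {0..upper_inverse t}" using u by auto
  finally show ?thesis using u distribution[of "upper_inverse t"] by simp
qed

text \<open>The probability integral transform: a continuous distribution function sends its measure to
  Lebesgue measure. Both measures have the same distribution function.\<close>

lemma emeasure_vimage_G:
  assumes B: "B \<in> sets borel" "B \<subseteq> {0..<1}"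
  shows "emeasure m {x \<in> {0..<1}. G x \<in> B} = emeasure lborel B"
proof -
  have G[measurable]: "G \<in> borel_measurable m" by (intro measurable_m borel_measurable_G)
  define P where "P = distr m borel G"
  define Q where "Q = uniform_measure lborel {0..<1::real}"
  interpret P: prob_space P unfolding P_def using G by (rule prob_space_distr)
  interpret Q: prob_space Q unfolding Q_def
    by (rule prob_space_uniform_measure) (simp_all add: emeasure_lborel_Ico)
  have "P = Q"
  proof (rule cdf_unique)
    show "real_distribution P" "real_distribution Q"
      by (unfold_locales) (auto simp: P_def Q_def)
    show "cdf P = cdf Q"
    proof
      fix t :: real
      have P: "cdf P t = measure m {x \<in> space m. G x \<le> t}"
        unfolding cdf_def P_def by (subst measure_distr) (auto intro!: arg_cong[of _ _ "measure m"])
      have Q: "cdf Q t = measure lborel ({0..<1} \<inter> {..t})"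
        unfolding cdf_def Q_def by (subst measure_uniform_measure) auto
      consider "t < 0" | "0 \<le> t" "t < 1" | "1 \<le> t" by linarith
      then show "cdf P t = cdf Q t"
      proof cases
        case 1
        then have "\<not> G x \<le> t" if "x \<in> space m" for x
          using G_bounds(1)[of x] that by (simp add: space_m)
        then have "{x \<in> space m. G x \<le> t} = {}" by blast
        moreover have "{0..<1} \<inter> {..t} = {}" using 1 by auto
        ultimately show ?thesis unfolding P Q by (simp only: measure_empty)
      next
        case 2
        then have "{0..<1} \<inter> {..t} = {0..t}" by auto
        then show ?thesis unfolding P Q using 2 measure_G_le by simp
      next
        case 3
        then have "G x \<le> t" if "x \<in> space m" for x
          using G_bounds(2)[of x] that by (simp add: space_m)
        then have "{x \<in> space m. G x \<le> t} = space m" by blast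
        moreover have "{0..<1} \<inter> {..t} = {0..<1}" using 3 by auto
        ultimately show ?thesis unfolding P Q by (simp add: prob_space)
      qed
    qed
  qed
  have "emeasure m {x \<in> {0..<1}. G x \<in> B} = emeasure P B"
    unfolding P_def using B
    by (subst emeasure_distr) (auto simp: space_m intro!: arg_cong[of _ _ "emeasure m"])
  also have "\<dots> = emeasure lborel ({0..<1} \<inter> B) / emeasure lborel {0..<1::real}"
    unfolding \<open>P = Q\<close> Q_def using B by (intro emeasure_uniform_measure) auto
  also have "\<dots> = emeasure lborel B" using B(2) by (simp add: Int_absorb1 divide_ennreal_def)
  finally show ?thesis .
qed

text \<open>Almost every point is a point of injectivity, since the plateau values form a Lebesgue null
  set. At these points \<open>upper_inverse\<close> undoes \<open>G\<close>; hence the image on the right consists of the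
  values \<open>t\<close> off the plateaus with \<open>f (upper_inverse t) \<in> A\<close> and is a Borel set, to which
  \<open>emeasure_vimage_G\<close> applies.\<close>

lemma emeasure_injectivity_transfer:
  assumes A: "A \<in> sets borel"
    and f: "f \<in> borel_measurable borel"
  shows "emeasure m {x \<in> {0..<1}. f x \<in> A}
    = emeasure lborel (G ` {x \<in> {0..<1} \<inter> injectivity_points. f x \<in> A})"
proof -
  note f [measurable] and A [measurable]
  have [measurable]: "upper_inverse \<in> borel_measurable borel"
    by (rule borel_measurable_mono[OF mono_upper_inverse])
  have N [measurable]: "plateau_values \<in> sets borel"
    by (rule sets.countable[OF _ countable_plateau_values]) simp
  define B where "B = {t \<in> {0..<1} - plateau_values. f (upper_inverse t) \<in> A}"
  have B: "B \<in> sets borel" "B \<subseteq> {0..<1}" unfolding B_def by auto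
  have G_eq: "G x \<in> B \<longleftrightarrow> G x < 1 \<and> x \<in> injectivity_points \<and> f x \<in> A" if "0 \<le> x" for x
    using that upper_inverse_injectivity_point[of x] G_bounds(1)[of x]
    by (auto simp: B_def injectivity_points_iff)
  have less_1: "G x < 1" if "x \<in> injectivity_points" "0 \<le> x" "x < 1" for x
  proof -
    have "G x \<noteq> 1" using injectivity_pointsD[OF that(1), of 1] that(3) by auto
    then show ?thesis using G_bounds(2)[of x] that by simp
  qed
  have [measurable]: "f \<in> borel_measurable m" "G \<in> borel_measurable m"
    by (intro measurable_m borel_measurable_G f)+
  have "AE x in m. G x \<in> {0..<1} - plateau_values"
  proof (rule AE_I_eq_1)
    have "emeasure m {x \<in> space m. G x \<in> {0..<1} - plateau_values}
        = emeasure lborel ({0..<1} - plateau_values)"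
      unfolding space_m by (rule emeasure_vimage_G) auto
    also have "\<dots> = emeasure lborel {0..<1::real}"
      by (rule emeasure_Diff_null_set)
        (auto simp: null_sets_def emeasure_lborel_countable countable_plateau_values)
    finally show "emeasure m {x \<in> space m. G x \<in> {0..<1} - plateau_values} = 1" by simp
  qed measurable
  then have "AE x in m. x \<in> {x \<in> space m. f x \<in> A} \<longleftrightarrow> x \<in> {x \<in> space m. G x \<in> B}"
  proof (rule AE_mp, intro AE_I2 impI)
    fix x assume "x \<in> space m" "G x \<in> {0..<1} - plateau_values"
    then show "x \<in> {x \<in> space m. f x \<in> A} \<longleftrightarrow> x \<in> {x \<in> space m. G x \<in> B}"
      using G_eq[of x] by (simp add: space_m injectivity_points_iff)
  qed
  then have "emeasure m {x \<in> space m. f x \<in> A} = emeasure m {x \<in> space m. G x \<in> B}"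
  proof (rule emeasure_eq_AE)
    show "{x \<in> space m. f x \<in> A} \<in> sets m" by measurable
    show "{x \<in> space m. G x \<in> B} \<in> sets m" using B by measurable
  qed
  then have "emeasure m {x \<in> {0..<1}. f x \<in> A} = emeasure m {x \<in> {0..<1}. G x \<in> B}"
    by (simp only: space_m)
  also have "\<dots> = emeasure lborel B" using B by (rule emeasure_vimage_G)
  also have "B = G ` {x \<in> {0..<1} \<inter> injectivity_points. f x \<in> A}"
  proof (intro equalityI subsetI)
    fix t assume t: "t \<in> B"
    define x where "x = upper_inverse t"
    have x: "G x = t" by (simp add: x_def)
    have "0 \<le> t" "t < 1" using t by (auto simp: B_def)
    then have x01: "0 \<le> x" "x < 1"
      using le_upper_inverse_iff[of 0 t] le_upper_inverse_iff[of 1 t] unfolding x_def by simp_all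
    have "x \<in> injectivity_points \<and> f x \<in> A" using G_eq[OF x01(1)] t unfolding x by simp
    then show "t \<in> G ` {x \<in> {0..<1} \<inter> injectivity_points. f x \<in> A}"
      using x x01 by (intro image_eqI[of _ _ x]) simp_all
  next
    fix t assume "t \<in> G ` {x \<in> {0..<1} \<inter> injectivity_points. f x \<in> A}"
    then obtain x where "0 \<le> x" "x < 1" "x \<in> injectivity_points" "f x \<in> A" "t = G x" by auto
    then show "t \<in> B" by (simp add: G_eq less_1)
  qed
  finally show ?thesis .
qed

end

section \<open>Lifts of orientation preserving homeomorphisms\<close>

text \<open>The difference of two lifts is continuous and takes integer values on a connected set.\<close>

lemma circle_lifts_differ_by_int:
  assumes "circle_lift f F" "circle_lift f F'"
  shows "\<exists>k::int. \<forall>x. F' x = F x + of_int k"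
proof -
  have int: "\<exists>k::int. F' x - F x = of_int k" for x
  proof -
    have "covering (F' x) = covering (F x)" using assms by (simp add: circle_lift_def)
    then show ?thesis unfolding covering_eq_iff by force
  qed
  have "(\<lambda>x. F' x - F x) constant_on UNIV"
  proof (rule continuous_discrete_range_constant)
    show "continuous_on UNIV (\<lambda>x. F' x - F x)"
      using assms by (intro continuous_intros) (auto simp: circle_lift_def)
    fix x :: real
    have "1 \<le> norm (F' y - F y - (F' x - F x))" if "F' y - F y \<noteq> F' x - F x" for y
      using int[of x] int[of y] that
      by (metis of_int_diff norm_of_int of_int_1_le_iff of_int_abs of_int_eq_iff real_norm_def
          right_minus_eq zero_less_abs_iff int_one_le_iff_zero_less)
    then show "\<exists>e>0. \<forall>y. y \<in> UNIV \<and> F' y - F y \<noteq> F' x - F x \<longrightarrow>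
        e \<le> norm (F' y - F y - (F' x - F x))"
      by (intro exI[of _ 1]) auto
  qed auto
  then show ?thesis
    using int unfolding constant_on_def
    by (metis UNIV_I add.commute diff_add_cancel)
qed

locale circle_homeo_lift =
  fixes \<phi> :: "complex \<Rightarrow> complex" and \<Phi> :: "real \<Rightarrow> real"
  assumes homeo: "orientation_preserving_homeo \<phi>" and lift: "circle_lift \<phi> \<Phi>"
begin

lemma continuous_lift: "continuous_on A \<Phi>"
  using lift continuous_on_subset by (auto simp: circle_lift_def)

lemma covering_lift: "covering (\<Phi> x) = \<phi> (covering x)"
  using lift by (simp add: circle_lift_def)

lemma covering_funpow: "covering ((\<Phi> ^^ n) x) = (\<phi> ^^ n) (covering x)"
  by (induction n) (auto simp: covering_lift)

lemma inj_on_circle: "inj_on \<phi> S1"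
  using homeo unfolding orientation_preserving_homeo_def homeomorphism_def
  by (metis inj_on_inverseI)

lemma strict_mono_lift: "strict_mono \<Phi>"
proof -
  obtain F where F: "circle_lift \<phi> F" "strict_mono F"
    using homeo by (auto simp: orientation_preserving_homeo_def)
  then obtain k :: int where "\<forall>x. \<Phi> x = F x + of_int k"
    using circle_lifts_differ_by_int lift by blast
  then show ?thesis using F(2) by (simp add: strict_mono_def)
qed

text \<open>The increment \<open>\<Phi> (x + 1) - \<Phi> x\<close> is a positive integer; were it at least \<open>2\<close>, the
  value \<open>\<Phi> x + 1\<close> would be attained strictly inside \<open>(x, x + 1)\<close>, against injectivity of
  the circle map.\<close>

lemma lift_add_1: "\<Phi> (x + 1) = \<Phi> x + 1"
proof -
  have "covering (\<Phi> (x + 1)) = covering (\<Phi> x)"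
    using covering_add_of_int[of x 1] by (simp add: covering_lift)
  then obtain k :: int where k: "\<Phi> (x + 1) = \<Phi> x + of_int k"
    unfolding covering_eq_iff by blast
  have "\<Phi> x < \<Phi> (x + 1)" by (intro strict_monoD[OF strict_mono_lift]) simp
  then have "k \<ge> 1" using k by simp
  have "\<not> k \<ge> 2"
  proof
    assume "k \<ge> 2"
    then have *: "\<Phi> x + 1 < \<Phi> (x + 1)" unfolding k by linarith
    then obtain y where y: "x \<le> y" "y \<le> x + 1" "\<Phi> y = \<Phi> x + 1"
      using IVT'[of \<Phi> x "\<Phi> x + 1" "x + 1"] continuous_lift by force
    then have "\<phi> (covering y) = \<phi> (covering x)"
      using covering_add_of_int[of "\<Phi> x" 1] by (simp flip: covering_lift)
    then have "covering y = covering x"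
      using inj_on_circle by (metis covering_in_S1 inj_onD)
    then obtain j :: int where j: "y = x + of_int j" unfolding covering_eq_iff by blast
    have "y \<noteq> x" "y \<noteq> x + 1" using y * by auto
    then show False using j y by auto
  qed
  then show ?thesis using k \<open>k \<ge> 1\<close> by (simp add: antisym_conv)
qed

end

sublocale circle_homeo_lift \<subseteq> lift: degree_one \<Phi>
  by unfold_locales (rule lift_add_1)

lemma (in circle_homeo_lift) lift_surj: "surj \<Phi>"
  by (rule lift.continuous_surj) (rule continuous_lift)

section \<open>The distribution function of an invariant measure\<close>

locale invariant_circle_measure = circle_homeo_lift +
  fixes \<mu> :: "complex measure"
  assumes invariant: "invariant_probability \<phi> \<mu>"
begin

abbreviation G :: "real \<Rightarrow> real" where "G \<equiv> Gamma_lift \<mu>"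

sublocale mu: prob_space \<mu>
  using invariant by (simp add: invariant_probability_def)

lemma sets_mu: "sets \<mu> = sets (restrict_space borel S1)"
  using invariant by (simp add: invariant_probability_def)

lemma space_mu: "space \<mu> = S1"
  using sets_eq_imp_space_eq[OF sets_mu] by (simp add: space_restrict_space)

lemma measurable_unit_coord [measurable]: "unit_coord \<in> borel_measurable \<mu>"
  by (subst measurable_cong_sets[OF sets_mu refl])
    (rule measurable_restrict_space1[OF borel_measurable_unit_coord])

lemma unit_coord_measurable_interval: "unit_coord \<in> measurable \<mu> (restrict_space borel {0..<1})"
  by (rule measurable_restrict_space2) (use unit_coord_bounds in auto)

lemma emeasure_interval_measure:
  assumes "B \<in> sets borel"
  shows "emeasure (interval_measure_of \<mu>) {x \<in> {0..<1}. x \<in> B}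
    = emeasure \<mu> {z \<in> space \<mu>. unit_coord z \<in> B}"
proof -
  have "{x \<in> {0..<1}. x \<in> B} \<in> sets (restrict_space borel {0..<1})"
    using assms by (auto simp: sets_restrict_space)
  then have "emeasure (interval_measure_of \<mu>) {x \<in> {0..<1}. x \<in> B}
      = emeasure \<mu> (unit_coord -` {x \<in> {0..<1}. x \<in> B} \<inter> space \<mu>)"
    unfolding interval_measure_of_def
    by (rule emeasure_distr[OF unit_coord_measurable_interval])
  also have "unit_coord -` {x \<in> {0..<1}. x \<in> B} \<inter> space \<mu> = {z \<in> space \<mu>. unit_coord z \<in> B}"
    using unit_coord_bounds by auto
  finally show ?thesis .
qed

lemma measure_interval_measure:
  assumes "0 \<le> t" "t < 1"
  shows "measure (interval_measure_of \<mu>) {0..t} = mu.prob {z \<in> space \<mu>. unit_coord z \<le> t}"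
proof -
  have "{0..t} = {x \<in> {0..<1}. x \<in> {..t}}" using assms by auto
  then show ?thesis using emeasure_interval_measure[of "{..t}"] by (simp add: measure_def)
qed

lemma Gamma_lift_eq:
  "G x = of_int \<lfloor>x\<rfloor> + mu.prob {z \<in> space \<mu>. unit_coord z \<le> frac x}"
  unfolding Gamma_lift_def by (subst measure_interval_measure) (simp_all add: frac_lt_1)

lemma Gamma_lift_add_1: "G (x + 1) = G x + 1"
  by (simp add: Gamma_lift_def frac_def)

sublocale degree_one "Gamma_lift \<mu>"
  by unfold_locales (rule Gamma_lift_add_1)

lemma Gamma_lift_near_id: "\<bar>G x - x\<bar> \<le> 1"
proof -
  have "G x - x = mu.prob {z \<in> space \<mu>. unit_coord z \<le> frac x} - frac x"
    by (simp add: Gamma_lift_eq frac_def)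
  then show ?thesis
    using mu.prob_le_1[of "{z \<in> space \<mu>. unit_coord z \<le> frac x}"] frac_lt_1[of x] frac_ge_0[of x]
      measure_nonneg[of \<mu> "{z \<in> space \<mu>. unit_coord z \<le> frac x}"]
    by linarith
qed

text \<open>Lets measurability of a projected set be read off from that of countably many translates.\<close>

lemma covering_image_eq:
  "covering ` B = {z \<in> space \<mu>. \<exists>k::int. unit_coord z + of_int k \<in> B}"
proof (intro equalityI subsetI)
  fix z assume "z \<in> covering ` B"
  then obtain x where x: "x \<in> B" "z = covering x" by blast
  have "unit_coord z + of_int \<lfloor>x\<rfloor> = x" by (simp add: x unit_coord_covering frac_def)
  then show "z \<in> {z \<in> space \<mu>. \<exists>k::int. unit_coord z + of_int k \<in> B}"
    using x by (auto simp: space_mu intro!: exI[of _ "\<lfloor>x\<rfloor>"])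
next
  fix z assume "z \<in> {z \<in> space \<mu>. \<exists>k::int. unit_coord z + of_int k \<in> B}"
  then obtain k :: int where k: "z \<in> S1" "unit_coord z + of_int k \<in> B" by (auto simp: space_mu)
  then have "covering (unit_coord z + of_int k) = z" by simp
  then show "z \<in> covering ` B" using k(2) by (metis imageI)
qed

lemma covering_image_sets:
  assumes [measurable]: "B \<in> sets borel"
  shows "covering ` B \<in> sets \<mu>"
proof -
  have [measurable]: "(\<lambda>z. unit_coord z + of_int k) \<in> borel_measurable \<mu>" for k :: int
    by measurable
  show ?thesis unfolding covering_image_eq by measurable
qed

text \<open>Bridges the measure on the circle and increments on the line. By periodicity \<open>a\<close> may be taken
  in \<open>[0,1)\<close>; the arc then either stays inside the fundamental domain or wraps around \<open>1\<close> once,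
  in which case its complement is a difference of two initial segments.\<close>

lemma measure_arc:
  assumes "a \<le> b" "b \<le> a + 1"
  shows "mu.prob (covering ` {a<..b}) = G b - G a"
proof -
  define D where "D t = mu.prob {z \<in> space \<mu>. unit_coord z \<le> t}" for t
  have base: "mu.prob (covering ` {a<..b}) = G b - G a"
    if ab: "0 \<le> a" "a < 1" "a \<le> b" "b \<le> a + 1" for a b
  proof -
    have Ga: "G a = D a" using ab floor_eq_iff[of a 0] frac_eq[of a] by (simp add: Gamma_lift_eq D_def)
    have shift: "of_int k < (1::real) \<Longrightarrow> k \<le> 0" "of_int k < (2::real) \<Longrightarrow> k \<le> 1"
      "of_int k > (-1::real) \<Longrightarrow> k \<ge> 0" for k by linarith+
    show ?thesis
    proof (cases "b < 1")
      case True
      have Gb: "G b = D b"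
        using ab True floor_eq_iff[of b 0] frac_eq[of b] by (simp add: Gamma_lift_eq D_def)
      have "covering ` {a<..b} = {z \<in> space \<mu>. a < unit_coord z \<and> unit_coord z \<le> b}"
      proof -
        have "(\<exists>k::int. unit_coord z + of_int k \<in> {a<..b}) \<longleftrightarrow> unit_coord z \<in> {a<..b}" for z
        proof
          assume "\<exists>k::int. unit_coord z + of_int k \<in> {a<..b}"
          then obtain k :: int where k: "a < unit_coord z + of_int k" "unit_coord z + of_int k \<le> b"
            by auto
          have "k = 0" using k ab True unit_coord_bounds[of z] shift[of k] by force
          then show "unit_coord z \<in> {a<..b}" using k by simp
        qed (auto intro: exI[of _ 0])
        then show ?thesis unfolding covering_image_eq by simp
      qed
      also have "\<dots> = {z \<in> space \<mu>. unit_coord z \<le> b} - {z \<in> space \<mu>. unit_coord z \<le> a}"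
        by auto
      also have "mu.prob \<dots> = D b - D a"
        unfolding D_def using ab(3) by (intro mu.finite_measure_Diff) (measurable, auto)
      finally show ?thesis using Ga Gb by simp
    next
      case False
      have "\<lfloor>b\<rfloor> = 1" using False ab by (simp add: floor_eq_iff)
      then have Gb: "G b = 1 + D (b - 1)" by (simp add: Gamma_lift_eq D_def frac_def)
      have "(\<exists>k::int. unit_coord z + of_int k \<in> {a<..b}) \<longleftrightarrow>
          a < unit_coord z \<or> unit_coord z \<le> b - 1" for z
      proof
        assume "\<exists>k::int. unit_coord z + of_int k \<in> {a<..b}"
        then obtain k :: int where k: "a < unit_coord z + of_int k" "unit_coord z + of_int k \<le> b"
          by auto
        have "k = 0 \<or> k = 1" using k ab False unit_coord_bounds[of z] shift[of k] by force
        then show "a < unit_coord z \<or> unit_coord z \<le> b - 1" using k by auto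
      next
        assume "a < unit_coord z \<or> unit_coord z \<le> b - 1"
        then show "\<exists>k::int. unit_coord z + of_int k \<in> {a<..b}"
        proof
          assume "a < unit_coord z"
          then show ?thesis using False unit_coord_bounds[of z] by (intro exI[of _ 0]) simp
        next
          assume "unit_coord z \<le> b - 1"
          then show ?thesis using ab unit_coord_bounds[of z] by (intro exI[of _ 1]) simp
        qed
      qed
      then have "covering ` {a<..b} = space \<mu> -
          ({z \<in> space \<mu>. unit_coord z \<le> a} - {z \<in> space \<mu>. unit_coord z \<le> b - 1})"
        unfolding covering_image_eq by auto
      also have "mu.prob \<dots> = 1 - (D a - D (b - 1))"
        unfolding D_def using ab
        by (subst mu.prob_compl, measurable, subst mu.finite_measure_Diff, measurable, auto)
      finally show ?thesis using Ga Gb by simp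
    qed
  qed
  define k where "k = \<lfloor>a\<rfloor>"
  have "covering ` {a<..b} = covering ` {a - of_int k<..b - of_int k}"
  proof -
    have "{a<..b} = (\<lambda>x. x + of_int k) ` {a - of_int k<..b - of_int k}"
    proof (intro equalityI subsetI)
      fix y assume "y \<in> {a<..b}"
      then show "y \<in> (\<lambda>x. x + of_int k) ` {a - of_int k<..b - of_int k}"
        by (intro image_eqI[of _ _ "y - of_int k"]) auto
    qed auto
    then show ?thesis by (simp only: image_image covering_add_of_int)
  qed
  also have "mu.prob \<dots> = G (b - of_int k) - G (a - of_int k)"
    by (rule base) (use assms in \<open>auto simp: k_def\<close>, linarith)
  also have "\<dots> = G b - G a"
    using add_of_int[of b "- k"] add_of_int[of a "- k"] by simp
  finally show ?thesis .
qed

lemma mono_Gamma_lift: "mono G"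
proof (rule monoI)
  fix a b :: real assume "a \<le> b"
  \<comment> \<open>Arcs only see intervals of length at most \<open>1\<close>, so whole turns are removed first.\<close>
  define k where "k = \<lfloor>b - a\<rfloor>"
  have "0 \<le> mu.prob (covering ` {a<..b - of_int k})" by (rule measure_nonneg)
  also have "\<dots> = G (b - of_int k) - G a" by (rule measure_arc) (simp_all add: k_def, linarith+)
  also have "\<dots> = G b - of_int k - G a" using add_of_int[of b "- k"] by simp
  finally have "G a + of_int k \<le> G b" by simp
  moreover have "0 \<le> k" using \<open>a \<le> b\<close> by (simp add: k_def)
  ultimately show "G a \<le> G b" by simp
qed

text \<open>The arc over \<open>(a,b]\<close> is the full preimage of the arc over \<open>(\<Phi> a, \<Phi> b]\<close>, by injectivity of
  the circle map.\<close>

lemma measure_arc_lift: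
  "mu.prob (covering ` {\<Phi> a<..\<Phi> b}) = mu.prob (covering ` {a<..b})"
proof -
  have "\<phi> -` (covering ` {\<Phi> a<..\<Phi> b}) \<inter> space \<mu> = covering ` {a<..b}"
  proof (intro equalityI subsetI)
    fix z assume "z \<in> \<phi> -` (covering ` {\<Phi> a<..\<Phi> b}) \<inter> space \<mu>"
    then obtain y where y: "\<Phi> a < y" "y \<le> \<Phi> b" "\<phi> z = covering y" and z: "z \<in> S1"
      by (auto simp: space_mu)
    obtain x where x: "y = \<Phi> x" using lift_surj by (metis surjD)
    have "\<phi> z = \<phi> (covering x)" using y x by (simp add: covering_lift)
    then have "z = covering x" using inj_on_circle z by (metis covering_in_S1 inj_onD)
    moreover have "a < x" "x \<le> b"
      using y x strict_mono_lift by (simp_all add: strict_mono_less strict_mono_less_eq)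
    ultimately show "z \<in> covering ` {a<..b}" by simp
  next
    fix z assume "z \<in> covering ` {a<..b}"
    then obtain x where x: "a < x" "x \<le> b" "z = covering x" by auto
    then have "\<phi> z = covering (\<Phi> x)" "\<Phi> a < \<Phi> x" "\<Phi> x \<le> \<Phi> b"
      using strict_mono_lift by (simp_all add: covering_lift strict_mono_less strict_mono_less_eq)
    then show "z \<in> \<phi> -` (covering ` {\<Phi> a<..\<Phi> b}) \<inter> space \<mu>" using x by (simp add: space_mu)
  qed
  moreover have "emeasure \<mu> (\<phi> -` (covering ` {\<Phi> a<..\<Phi> b}) \<inter> space \<mu>)
      = emeasure \<mu> (covering ` {\<Phi> a<..\<Phi> b})"
    using invariant covering_image_sets[of "{\<Phi> a<..\<Phi> b}"]
    unfolding invariant_probability_def by simp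
  ultimately show ?thesis by (simp add: measure_def)
qed

text \<open>Equal measure of an arc and of its image means that \<open>G \<circ> \<Phi>\<close> and \<open>G\<close> have equal
  increments.\<close>

lemma Gamma_lift_semiconjugacy: "\<exists>c. \<forall>x. G (\<Phi> x) = G x + c"
proof (intro exI allI)
  fix x :: real
  define y :: real where "y = frac x"
  have y: "0 \<le> y" "y \<le> 1" "x = y + of_int \<lfloor>x\<rfloor>"
    using frac_lt_1[of x] by (simp_all add: y_def frac_def)
  have "\<Phi> 0 \<le> \<Phi> y" "\<Phi> y \<le> \<Phi> 0 + 1"
    using y strict_mono_less_eq[OF strict_mono_lift, of 0 y]
      strict_mono_less_eq[OF strict_mono_lift, of y "0 + 1"] lift_add_1[of 0] by simp_all
  then have "G (\<Phi> y) - G (\<Phi> 0) = G y - G 0"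
    using measure_arc[of "\<Phi> 0" "\<Phi> y"] measure_arc[of 0 y] measure_arc_lift[of 0 y] y by simp
  moreover have "G (\<Phi> x) = G (\<Phi> y) + of_int \<lfloor>x\<rfloor>"
    by (subst y(3)) (simp only: lift.add_of_int add_of_int)
  moreover have "G x = G y + of_int \<lfloor>x\<rfloor>"
    by (subst y(3)) (simp only: add_of_int)
  ultimately show "G (\<Phi> x) = G x + (G (\<Phi> 0) - G 0)" by simp
qed

text \<open>The lift \<open>F\<close> realising the rotation number is \<open>\<Phi> + j\<close>, and \<open>G (F\<^sup>n 0) = G 0 + n(c + j)\<close>.
  As \<open>G\<close> is within \<open>1\<close> of the identity, \<open>F\<^sup>n 0 / n\<close> tends to \<open>c + j\<close>, so \<open>c\<close> and \<open>\<rho>\<close>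
  differ by an integer. From \<open>0 < \<Phi> 0 < 1\<close> one gets \<open>0 \<le> c \<le> 1\<close>, and only \<open>c = \<rho>\<close> is
  left because \<open>0 < \<rho> < 1\<close>.\<close>

lemma Gamma_lift_rotation:
  assumes rot: "has_rotation_number \<phi> \<rho>" "\<rho> \<in> {0<..<1}" and \<Phi>0: "\<Phi> 0 \<in> {0<..<1}"
  shows "G (\<Phi> x) = G x + \<rho>"
proof -
  obtain c where c: "\<And>x. G (\<Phi> x) = G x + c" using Gamma_lift_semiconjugacy by blast
  obtain F and k :: int where F: "circle_lift \<phi> F"
    and lim: "\<And>x. (\<lambda>n. (F ^^ n) x / real n) \<longlonglongrightarrow> \<rho> + of_int k"
    using rot(1) by (auto simp: has_rotation_number_def)
  obtain j :: int where j: "\<And>x. F x = \<Phi> x + of_int j"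
    using circle_lifts_differ_by_int[OF lift F] by blast
  have G_F: "G (F x) = G x + (c + of_int j)" for x
    by (simp add: j c add_of_int)
  have G_iter: "G ((F ^^ n) x) = G x + real n * (c + of_int j)" for n x
    by (induction n) (simp_all add: G_F algebra_simps)
  have "(\<lambda>n. (F ^^ n) 0 / real n) \<longlonglongrightarrow> c + of_int j"
  proof (rule LIMSEQ_I)
    fix r :: real assume "0 < r"
    \<comment> \<open>Bounds \<open>F\<^sup>n 0 - n(c + j)\<close> for all \<open>n\<close>.\<close>
    define C where "C = \<bar>G 0\<bar> + 1"
    obtain N :: nat where N: "C / r < real N" using reals_Archimedean2 by blast
    have "norm ((F ^^ n) 0 / real n - (c + of_int j)) < r" if "n \<ge> N" for n
    proof -
      have "C > 0" by (simp add: C_def)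
      have "C / r < real n" using N that by simp
      moreover have "0 < C / r" using \<open>C > 0\<close> \<open>0 < r\<close> by simp
      ultimately have n: "real n > 0" by linarith
      have "C < r * real n" using \<open>C / r < real n\<close> \<open>0 < r\<close> by (simp add: field_simps)
      have "\<bar>(F ^^ n) 0 - real n * (c + of_int j)\<bar> \<le> C"
        using Gamma_lift_near_id[of "(F ^^ n) 0"] unfolding G_iter C_def by linarith
      also have "(F ^^ n) 0 - real n * (c + of_int j)
          = real n * ((F ^^ n) 0 / real n - (c + of_int j))"
        using n by (simp add: field_simps)
      finally have "real n * \<bar>(F ^^ n) 0 / real n - (c + of_int j)\<bar> \<le> C"
        by (simp only: abs_mult abs_of_nat)
      also have "\<dots> < real n * r" using \<open>C < r * real n\<close> by (simp add: mult.commute)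
      finally show ?thesis using n by simp
    qed
    then show "\<exists>no. \<forall>n\<ge>no. norm ((F ^^ n) 0 / real n - (c + of_int j)) < r" by blast
  qed
  then have "c + of_int j = \<rho> + of_int k" using lim LIMSEQ_unique by blast
  then have eq: "c - \<rho> = of_int (k - j)" by simp
  have "c = G (\<Phi> 0) - G 0" using c[of 0] by simp
  moreover have "G 0 \<le> G (\<Phi> 0)" "G (\<Phi> 0) \<le> G (0 + 1)"
    using \<Phi>0 by (auto intro!: monoD[OF mono_Gamma_lift])
  ultimately have "0 \<le> c" "c \<le> 1" using Gamma_lift_add_1[of 0] by auto
  then have "- 1 < real_of_int (k - j)" "real_of_int (k - j) < 1"
    using rot(2) unfolding eq[symmetric] by auto
  then have "k - j = 0" by linarith
  then show ?thesis using eq c by simp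
qed

end

section \<open>Semiconjugacy to an irrational rotation\<close>

locale irrational_semiconjugacy = invariant_circle_measure +
  fixes \<rho> :: real
  assumes irrational: "\<rho> \<notin> \<rat>" and semiconjugacy: "\<And>x. G (\<Phi> x) = G x + \<rho>"
begin

lemma semiconjugacy_funpow: "G ((\<Phi> ^^ n) x) = G x + real n * \<rho>"
  by (induction n) (simp_all add: semiconjugacy algebra_simps)

text \<open>Kronecker's theorem in terms of the map: along the forward orbit of any point the values of
  \<open>G\<close>, up to integers, are \<open>G x + n\<rho> + j\<close>.\<close>

lemma dense_orbit_values:
  assumes "s < t"
  obtains n :: nat and j :: int where "s < G ((\<Phi> ^^ n) x + of_int j)" "G ((\<Phi> ^^ n) x + of_int j) < t"
proof -
  \<comment> \<open>Approximate the midpoint of the target interval within half its length.\<close>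
  have "0 < (t - s) / 2" using assms by simp
  then obtain h k :: int where hk: "k > 0"
    "\<bar>of_int k * \<rho> - of_int h - ((s + t) / 2 - G x)\<bar> < (t - s) / 2"
    by (rule sequence_of_fractional_parts_is_dense[OF irrational])
  have "G ((\<Phi> ^^ nat k) x + of_int (- h)) = G x + of_int k * \<rho> - of_int h"
    unfolding add_of_int semiconjugacy_funpow using hk(1) by simp
  moreover have "s < G x + of_int k * \<rho> - of_int h" "G x + of_int k * \<rho> - of_int h < t"
    using hk(2) by (auto simp: abs_less_iff field_simps)
  ultimately show ?thesis using that[of "nat k" "- h"] by simp
qed

text \<open>A monotone function with a dense set of values cannot jump.\<close>

lemma continuous_Gamma_lift: "continuous_on UNIV G"
proof -
  have "isCont G x" for x
    unfolding continuous_at_eps_delta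
  proof (intro allI impI)
    fix e :: real assume "0 < e"
    then obtain p q where pq: "G x - e < G p" "G p < G x" "G x < G q" "G q < G x + e"
      using dense_orbit_values[of "G x - e" "G x" 0] dense_orbit_values[of "G x" "G x + e" 0]
      by (metis add_diff_cancel_right' diff_add_cancel less_add_same_cancel1)
    have "p < x" "x < q" using pq monoD[OF mono_Gamma_lift] by (meson not_le)+
    have "dist (G y) (G x) < e" if "dist y x < min (x - p) (q - x)" for y
    proof -
      have "p \<le> y" "y \<le> q" using that by (auto simp: dist_real_def)
      then have "G p \<le> G y" "G y \<le> G q" using monoD[OF mono_Gamma_lift] by auto
      then show ?thesis using pq by (auto simp: dist_real_def)
    qed
    then show "\<exists>d>0. \<forall>y. dist y x < d \<longrightarrow> dist (G y) (G x) < e"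
      using \<open>p < x\<close> \<open>x < q\<close> by (intro exI[of _ "min (x - p) (q - x)"]) auto
  qed
  then show ?thesis by (simp add: continuous_at_imp_continuous_on)
qed

lemma prob_space_interval_measure: "prob_space (interval_measure_of \<mu>)"
  unfolding interval_measure_of_def
  by (rule mu.prob_space_distr[OF unit_coord_measurable_interval])

lemma distribution_lift_Gamma_lift: "distribution_lift G (interval_measure_of \<mu>)"
proof (intro distribution_lift.intro distribution_lift_axioms.intro prob_space_interval_measure)
  show "monotone_degree_one G"
    by unfold_locales (rule mono_Gamma_lift continuous_Gamma_lift)+
  show "sets (interval_measure_of \<mu>) = sets (restrict_space borel {0..<1})"
    by (simp add: interval_measure_of_def)
  show "G x = measure (interval_measure_of \<mu>) {0..x}" if "0 \<le> x" "x < 1" for x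
    using that floor_eq_iff[of x 0] frac_eq[of x] by (simp add: Gamma_lift_def)
qed

sublocale distribution_lift "Gamma_lift \<mu>" "interval_measure_of \<mu>"
  by (rule distribution_lift_Gamma_lift)

lemma lift_mem_growth_points:
  assumes "x \<in> growth_points"
  shows "\<Phi> x \<in> growth_points"
  unfolding growth_points_def
proof (intro CollectI allI impI)
  fix a b assume ab: "a < \<Phi> x" "\<Phi> x < b"
  obtain a' b' where a': "a = \<Phi> a'" "b = \<Phi> b'" using lift_surj by (metis surjD)
  then have "a' < x" "x < b'" using ab strict_mono_lift by (simp_all add: strict_mono_less)
  then have "G a' < G b'" using assms unfolding growth_points_def by blast
  then show "G a < G b" by (simp add: a' semiconjugacy)
qed

lemma lift_mem_injectivity_points:
  assumes "x \<in> injectivity_points"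
  shows "\<Phi> x \<in> injectivity_points"
  unfolding injectivity_points_def
proof (intro CollectI allI impI)
  fix y assume y: "G y = G (\<Phi> x)"
  obtain y' where y': "y = \<Phi> y'" using lift_surj by (metis surjD)
  then have "G y' = G x" using y by (simp add: semiconjugacy)
  then show "y = \<Phi> x" using injectivity_pointsD[OF assms] y' by blast
qed

lemma displacement_add_of_int: "displacement \<Phi> (x + of_int k) = displacement \<Phi> x"
  by (simp add: displacement_def lift.add_of_int)

lemma continuous_displacement: "continuous_on A (displacement \<Phi>)"
  unfolding displacement_def by (intro continuous_intros continuous_lift)

lemma emeasure_displacement_distribution:
  assumes "A \<in> sets borel"
  shows "emeasure (displacement_distribution \<mu> \<Phi>) A
    = emeasure (interval_measure_of \<mu>) {x \<in> {0..<1}. displacement \<Phi> x \<in> A}"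
proof -
  have "displacement \<Phi> \<in> borel_measurable (interval_measure_of \<mu>)"
    by (intro measurable_m borel_measurable_continuous_onI continuous_displacement)
  then have "emeasure (displacement_distribution \<mu> \<Phi>) A
      = emeasure (interval_measure_of \<mu>) (displacement \<Phi> -` A \<inter> space (interval_measure_of \<mu>))"
    unfolding displacement_distribution_def using assms by (rule emeasure_distr)
  also have "displacement \<Phi> -` A \<inter> space (interval_measure_of \<mu>)
      = {x \<in> {0..<1}. displacement \<Phi> x \<in> A}"
    by (auto simp: space_m)
  finally show ?thesis .
qed

text \<open>The common form of both transport formulas; the point set on the right is the one on which
  \<open>G\<close> can be inverted.\<close>

lemma displacement_distribution_transport:
  assumes "A \<in> sets borel"
  shows "emeasure (displacement_distribution \<mu> \<Phi>) A
    = emeasure lborel (G ` {x \<in> {0..<1} \<inter> injectivity_points. displacement \<Phi> x \<in> A})"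
  unfolding emeasure_displacement_distribution[OF assms]
  by (intro emeasure_injectivity_transfer assms borel_measurable_continuous_onI
      continuous_displacement)

lemma displacement_image_periodic:
  assumes "\<And>x k. x + of_int k \<in> S \<longleftrightarrow> x \<in> S"
  shows "displacement \<Phi> ` S = displacement \<Phi> ` (S \<inter> {0..<1})"
proof (intro equalityI subsetI)
  fix v assume "v \<in> displacement \<Phi> ` S"
  then obtain x where x: "x \<in> S" "v = displacement \<Phi> x" by blast
  have eq: "x = frac x + of_int \<lfloor>x\<rfloor>" by (simp add: frac_def)
  have "frac x \<in> S" using assms[of "frac x" "\<lfloor>x\<rfloor>"] x(1) unfolding eq[symmetric] by simp
  moreover have "displacement \<Phi> (frac x) = v"
    using displacement_add_of_int[of "frac x" "\<lfloor>x\<rfloor>"] x(2) unfolding eq[symmetric] by simp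
  ultimately show "v \<in> displacement \<Phi> ` (S \<inter> {0..<1})" by (force simp: frac_lt_1)
qed auto

text \<open>Outside the compact image of the growth points nothing is charged, since almost every point is a
  growth point. Near a value \<open>\<Psi> t\<close> at a growth point \<open>t\<close> there is mass: an arc around \<open>t\<close> has
  positive measure. Arcs on the circle are used because for \<open>t = 0\<close> the neighbourhood wraps
  around the end of \<open>[0,1)\<close>.\<close>

lemma support_displacement_distribution:
  "measure_support (displacement_distribution \<mu> \<Phi>) = displacement \<Phi> ` (growth_points \<inter> {0..<1})"
proof (intro equalityI subsetI)
  fix v assume v: "v \<in> measure_support (displacement_distribution \<mu> \<Phi>)"
  \<comment> \<open>The closed interval \<open>[0,1]\<close> gives the same image by periodicity, but a compact set.\<close>
  define K where "K = displacement \<Phi> ` (growth_points \<inter> {0..1})"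
  have K: "displacement \<Phi> ` growth_points = displacement \<Phi> ` (growth_points \<inter> {0..<1})"
    by (rule displacement_image_periodic) (rule growth_points_add_of_int)
  have "compact K"
    unfolding K_def
    by (intro compact_continuous_image continuous_displacement closed_Int_compact
        closed_growth_points compact_Icc)
  then have op: "open (- K)" by (simp add: compact_imp_closed open_Compl)
  have "- K \<in> sets borel" using op by (rule borel_open)
  moreover have none: "{x \<in> {0..<1} \<inter> injectivity_points. displacement \<Phi> x \<in> - K} = {}"
    using injectivity_points_subset_growth by (auto simp: K_def)
  ultimately have "emeasure (displacement_distribution \<mu> \<Phi>) (- K) = 0"
    by (simp only: displacement_distribution_transport none image_empty emeasure_empty)
  then have "v \<in> K" using v op unfolding measure_support_def by force
  then show "v \<in> displacement \<Phi> ` (growth_points \<inter> {0..<1})" using K by (auto simp: K_def)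
next
  fix v assume "v \<in> displacement \<Phi> ` (growth_points \<inter> {0..<1})"
  then obtain t where t: "t \<in> growth_points" "v = displacement \<Phi> t" by blast
  show "v \<in> measure_support (displacement_distribution \<mu> \<Phi>)"
    unfolding measure_support_def
  proof (intro CollectI allI impI)
    fix U assume U: "open U \<and> v \<in> U"
    have "open (displacement \<Phi> -` U)"
      using continuous_displacement U by (intro open_vimage) auto
    then obtain e where e: "e > 0" "\<And>x. dist x t < e \<Longrightarrow> displacement \<Phi> x \<in> U"
      using U t unfolding open_dist by (metis vimage_eq)
    \<comment> \<open>The bound \<open>1/2\<close> keeps the arc from wrapping around the circle.\<close>
    define d where "d = min (e / 2) (1 / 2)"
    have d: "0 < d" "d < e" "d \<le> 1/2" using e by (auto simp: d_def)
    have "G (t - d) < G (t + d)" using t d unfolding growth_points_def by simp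
    then have "0 < emeasure \<mu> (covering ` {t - d<..t + d})"
      using measure_arc[of "t - d" "t + d"] d by (simp add: mu.emeasure_eq_measure)
    also have "\<dots> \<le> emeasure \<mu> {z \<in> space \<mu>. unit_coord z \<in> displacement \<Phi> -` U}"
    proof (rule emeasure_mono)
      have "displacement \<Phi> -` U \<in> sets borel" by (rule borel_open) fact
      then show "{z \<in> space \<mu>. unit_coord z \<in> displacement \<Phi> -` U} \<in> sets \<mu>"
        using measurable_sets[OF measurable_unit_coord, of "displacement \<Phi> -` U"]
        by (simp add: vimage_def Int_def conj_commute)
      show "covering ` {t - d<..t + d} \<subseteq> {z \<in> space \<mu>. unit_coord z \<in> displacement \<Phi> -` U}"
      proof
        fix z assume "z \<in> covering ` {t - d<..t + d}"
        then obtain x where x: "t - d < x" "x \<le> t + d" "z = covering x" by auto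
        have "displacement \<Phi> x \<in> U" using x d by (intro e) (auto simp: dist_real_def)
        moreover have "displacement \<Phi> (frac x) = displacement \<Phi> x"
          using displacement_add_of_int[of x "- \<lfloor>x\<rfloor>"] by (simp add: frac_def)
        ultimately show "z \<in> {z \<in> space \<mu>. unit_coord z \<in> displacement \<Phi> -` U}"
          using x(3) by (simp add: space_mu unit_coord_covering)
      qed
    qed
    also have "\<dots> = emeasure (displacement_distribution \<mu> \<Phi>) U"
    proof -
      have "emeasure (interval_measure_of \<mu>) {x \<in> {0..<1}. x \<in> displacement \<Phi> -` U}
          = emeasure \<mu> {z \<in> space \<mu>. unit_coord z \<in> displacement \<Phi> -` U}"
        by (rule emeasure_interval_measure[OF borel_open]) fact
      moreover have "emeasure (displacement_distribution \<mu> \<Phi>) U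
          = emeasure (interval_measure_of \<mu>) {x \<in> {0..<1}. displacement \<Phi> x \<in> U}"
        using U by (intro emeasure_displacement_distribution borel_open) simp
      ultimately show ?thesis by (simp only: vimage_eq)
    qed
    finally show "0 < emeasure (displacement_distribution \<mu> \<Phi>) U" .
  qed
qed

section \<open>Transitive maps and minimal sets\<close>

text \<open>The values of \<open>G\<close> along an orbit are distinct modulo the integers, so an orbit visits a
  plateau at most once, whereas a dense orbit visits both halves of it.\<close>

lemma transitive_imp_strict_mono:
  assumes "transitive_on_circle \<phi>"
  shows "strict_mono G"
proof (rule strict_monoI, rule ccontr)
  fix a b :: real assume ab: "a < b" "\<not> G a < G b"
  obtain z where z: "z \<in> S1" "S1 \<subseteq> closure (range (\<lambda>n. (\<phi> ^^ n) z))"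
    using assms unfolding transitive_on_circle_def by blast
  define x where "x = unit_coord z"
  have orbit: "(\<phi> ^^ n) z = covering ((\<Phi> ^^ n) x)" for n
    using z by (simp add: covering_funpow x_def)
  have visit: "\<exists>n j. p < (\<Phi> ^^ n) x + of_int j \<and> (\<Phi> ^^ n) x + of_int j < q"
    if "p < q" for p q
  proof -
    have "covering ((p + q) / 2) \<in> closure (range (\<lambda>n. (\<phi> ^^ n) z))" using z(2) by auto
    moreover have "range (\<lambda>n. (\<phi> ^^ n) z) \<subseteq> S1" unfolding orbit by auto
    ultimately have "\<exists>y. p < y \<and> y < q \<and> covering y \<in> range (\<lambda>n. (\<phi> ^^ n) z)"
      by (rule closure_circle_lift) (use that in simp_all)
    then obtain y where y: "p < y" "y < q" "covering y \<in> range (\<lambda>n. (\<phi> ^^ n) z)" by blast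
    then obtain n where "covering y = covering ((\<Phi> ^^ n) x)" unfolding orbit by auto
    then obtain j :: int where "y = (\<Phi> ^^ n) x + of_int j" unfolding covering_eq_iff by blast
    then show ?thesis using y by blast
  qed
  \<comment> \<open>Visiting two disjoint halves forces two different times.\<close>
  obtain n j n' j' where
    n: "a < (\<Phi> ^^ n) x + of_int j" "(\<Phi> ^^ n) x + of_int j < (a + b) / 2" and
    n': "(a + b) / 2 < (\<Phi> ^^ n') x + of_int j'" "(\<Phi> ^^ n') x + of_int j' < b"
    using visit[of a "(a + b) / 2"] visit[of "(a + b) / 2" b] ab(1) by auto
  have flat: "G y = G a" if "a < y" "y < b" for y
    using monoD[OF mono, of a y] monoD[OF mono, of y b] that ab by simp
  have eq: "G x + real n * \<rho> + of_int j = G x + real n' * \<rho> + of_int j'"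
    using flat[of "(\<Phi> ^^ n) x + of_int j"] flat[of "(\<Phi> ^^ n') x + of_int j'"] n n' ab(1)
    unfolding add_of_int semiconjugacy_funpow by simp
  show False
  proof (cases "n = n'")
    case True
    then show False using eq n n' by simp
  next
    case False
    have "\<rho> = of_int (j' - j) / of_int (int n - int n')"
      using eq False by (simp add: field_simps)
    then have "\<rho> \<in> \<rat>" by (simp only: Rats_divide Rats_of_int)
    then show False using irrational by simp
  qed
qed

text \<open>Let \<open>S\<close> be the projection of the growth points. Each \<open>y\<close> in the lift of \<open>S\<close> is surrounded by an
  interval on which \<open>G\<close> grows, and the orbit of any point of \<open>D\<close> enters it by density of the
  values of \<open>G\<close>; as \<open>D\<close> is closed, \<open>S \<subseteq> D\<close>. Moreover \<open>S\<close> is non-empty, closed and forward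
  invariant, so minimality gives \<open>S = D\<close>.\<close>

lemma minimal_set_lift:
  assumes "minimal_set \<phi> D"
  shows "covering x \<in> D \<longleftrightarrow> x \<in> growth_points"
proof -
  define S where "S = covering ` growth_points"
  have S: "covering x \<in> S \<longleftrightarrow> x \<in> growth_points" for x
    unfolding S_def image_iff covering_eq_iff by (metis growth_points_add_of_int add.right_neutral of_int_0)
  have D: "D \<subseteq> S1" "D \<noteq> {}" "closed D" "\<phi> ` D \<subseteq> D"
    "\<And>K. K \<subseteq> D \<Longrightarrow> K \<noteq> {} \<Longrightarrow> closed K \<Longrightarrow> \<phi> ` K \<subseteq> K \<Longrightarrow> K = D"
    using assms unfolding minimal_set_def by auto
  have "S \<subseteq> D"
  proof
    fix w assume "w \<in> S"
    then obtain y where y: "y \<in> growth_points" "w = covering y" unfolding S_def by blast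
    obtain z where z: "z \<in> D" using D(2) by blast
    define x where "x = unit_coord z"
    have orbit: "covering ((\<Phi> ^^ n) x + of_int j) \<in> D" for n j
    proof (induction n arbitrary: j)
      case 0
      then show ?case using z D(1) by (auto simp: x_def)
    next
      case (Suc n)
      have "\<phi> (covering ((\<Phi> ^^ n) x)) \<in> D" using Suc[of 0] D(4) by auto
      then show ?case by (simp add: covering_lift)
    qed
    have "w \<in> closure D"
      unfolding closure_approachable
    proof (intro allI impI)
      fix e :: real assume "0 < e"
      have "isCont covering y"
        using continuous_on_covering[of UNIV] by (simp add: continuous_on_eq_continuous_at)
      then obtain d where d: "d > 0" "\<And>u. dist u y < d \<Longrightarrow> dist (covering u) (covering y) < e"
        using \<open>0 < e\<close> unfolding continuous_at_eps_delta by blast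
      have "G (y - d) < G (y + d)" using y d(1) unfolding growth_points_def by simp
      then obtain n j where nj: "G (y - d) < G ((\<Phi> ^^ n) x + of_int j)"
        "G ((\<Phi> ^^ n) x + of_int j) < G (y + d)"
        by (rule dense_orbit_values)
      have "y - d < (\<Phi> ^^ n) x + of_int j" using nj(1) by (rule less_imp_less)
      moreover have "(\<Phi> ^^ n) x + of_int j < y + d" using nj(2) by (rule less_imp_less)
      ultimately have "dist (covering ((\<Phi> ^^ n) x + of_int j)) (covering y) < e"
        by (intro d) (auto simp: dist_real_def)
      then show "\<exists>u\<in>D. dist u w < e" using orbit y(2) by blast
    qed
    then show "w \<in> D" using D(3) by simp
  qed
  moreover have "S \<noteq> {}" using upper_inverse_growth unfolding S_def by blast
  moreover have "closed S"
  proof -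
    have "S = covering ` (growth_points \<inter> {0..1})"
    proof (intro equalityI subsetI)
      fix w assume "w \<in> S"
      then obtain y where y: "y \<in> growth_points" "w = covering y" unfolding S_def by blast
      have eq: "y = frac y + of_int \<lfloor>y\<rfloor>" by (simp add: frac_def)
      have "frac y \<in> growth_points"
        using growth_points_add_of_int[of "frac y" "\<lfloor>y\<rfloor>"] y(1) unfolding eq[symmetric] by simp
      moreover have "covering (frac y) = w"
        using covering_add_of_int[of "frac y" "\<lfloor>y\<rfloor>"] y(2) unfolding eq[symmetric] by simp
      moreover have "frac y \<in> {0..1}" using frac_lt_1[of y] by simp
      ultimately show "w \<in> covering ` (growth_points \<inter> {0..1})" by blast
    qed (auto simp: S_def)
    then show ?thesis
      by (simp add: compact_imp_closed compact_continuous_image continuous_on_covering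
          closed_Int_compact closed_growth_points)
  qed
  moreover have "\<phi> ` S \<subseteq> S"
    using lift_mem_growth_points unfolding S_def by (auto simp flip: covering_lift)
  ultimately have "S = D" by (rule D(5))
  then show ?thesis using S by simp
qed

lemma gamma_circle_covering: "gamma_circle \<mu> (covering x) = covering (G x)"
proof -
  have "G x = G (frac x) + of_int \<lfloor>x\<rfloor>" by (simp add: frac_def flip: add_of_int)
  then show ?thesis by (simp add: gamma_circle_def unit_coord_covering)
qed

text \<open>Two points of the circle have the same image under \<^const>\<open>gamma_circle\<close> iff suitable lifts of
  them have the same image under \<open>G\<close>. Hence the points removed from \<open>D\<close> are those sharing
  their fibre with another growth point.\<close>

lemma Delta_hat_eq:
  assumes "minimal_set \<phi> D"
  shows "Delta_hat \<mu> D = injectivity_points \<inter> {0..<1}"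
proof -
  have "covering x \<in> D - noninjective_points \<mu> D \<longleftrightarrow> x \<in> injectivity_points" for x
  proof -
    have "covering x \<in> noninjective_points \<mu> D \<longleftrightarrow>
        x \<in> growth_points \<and> (\<exists>y\<in>growth_points. G y = G x \<and> y \<noteq> x)"
    proof
      assume x: "covering x \<in> noninjective_points \<mu> D"
      then have growth: "x \<in> growth_points"
        using minimal_set_lift[OF assms] by (simp add: noninjective_points_def)
      obtain w where w: "w \<in> D" "w \<noteq> covering x" "gamma_circle \<mu> w = gamma_circle \<mu> (covering x)"
        using x unfolding noninjective_points_def by blast
      have "D \<subseteq> S1" using assms unfolding minimal_set_def by (rule conjunct1)
      then have "w \<in> S1" using w(1) by (rule subsetD)
      then have wu: "covering (unit_coord w) = w" by simp
      have "gamma_circle \<mu> w = covering (G (unit_coord w))"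
        using gamma_circle_covering[of "unit_coord w"] unfolding wu .
      then have "covering (G x) = covering (G (unit_coord w))"
        using w(3) by (simp add: gamma_circle_covering)
      then obtain k :: int where k: "G x = G (unit_coord w) + of_int k"
        unfolding covering_eq_iff by blast
      \<comment> \<open>The lift of \<open>w\<close> in the same fibre of \<open>G\<close> as \<open>x\<close>.\<close>
      define y where "y = unit_coord w + of_int k"
      have y: "covering y = w" by (simp add: y_def wu)
      have "y \<in> growth_points" using minimal_set_lift[OF assms, of y] w(1) y by simp
      moreover have "G y = G x" by (simp add: k y_def add_of_int)
      moreover have "y \<noteq> x" using y w(2) by auto
      ultimately show "x \<in> growth_points \<and> (\<exists>y\<in>growth_points. G y = G x \<and> y \<noteq> x)"
        using growth by blast
    next
      assume "x \<in> growth_points \<and> (\<exists>y\<in>growth_points. G y = G x \<and> y \<noteq> x)"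
      then obtain y where x: "x \<in> growth_points" and y: "y \<in> growth_points" "G y = G x" "y \<noteq> x"
        by blast
      have "covering y \<noteq> covering x"
      proof
        assume "covering y = covering x"
        then obtain k :: int where k: "y = x + of_int k" unfolding covering_eq_iff by blast
        then have "k = 0" using y(2) by (simp add: add_of_int)
        then show False using k y(3) by simp
      qed
      moreover have "gamma_circle \<mu> (covering y) = gamma_circle \<mu> (covering x)"
        by (simp add: gamma_circle_covering y(2))
      ultimately show "covering x \<in> noninjective_points \<mu> D"
        using minimal_set_lift[OF assms] x y(1) unfolding noninjective_points_def by blast
    qed
    then show ?thesis
      using minimal_set_lift[OF assms, of x] injectivity_points_iff_growth[of x] by blast
  qed
  then show ?thesis by (auto simp: Delta_hat_def lift_set_def)
qed

lemma injectivity_points_add_of_int: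
  "x + of_int k \<in> injectivity_points \<longleftrightarrow> x \<in> injectivity_points"
proof -
  have *: "x + of_int k \<in> injectivity_points" if "x \<in> injectivity_points" for x k
    unfolding injectivity_points_def
  proof (intro CollectI allI impI)
    fix y assume "G y = G (x + of_int k)"
    then have "G (y + of_int (- k)) = G x" unfolding add_of_int by simp
    then have "y + of_int (- k) = x" by (rule injectivity_pointsD[OF that])
    then show "y = x + of_int k" by simp
  qed
  show ?thesis using *[of x k] *[of "x + of_int k" "- k"] by auto
qed

lemma Gamma_hat_inv_eq:
  assumes D: "minimal_set \<phi> D" and x: "x \<in> injectivity_points"
  shows "Gamma_hat_inv \<mu> D (G x) = x"
proof -
  have "{x + of_int k |x k. x \<in> Delta_hat \<mu> D} = injectivity_points"
  proof (intro equalityI subsetI)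
    fix y assume "y \<in> injectivity_points"
    then have "frac y \<in> injectivity_points"
      using injectivity_points_add_of_int[of y "- \<lfloor>y\<rfloor>"] by (simp add: frac_def)
    then have "frac y \<in> Delta_hat \<mu> D" unfolding Delta_hat_eq[OF D] by (simp add: frac_lt_1)
    moreover have "y = frac y + of_int \<lfloor>y\<rfloor>" by (simp add: frac_def)
    ultimately show "y \<in> {x + of_int k |x k. x \<in> Delta_hat \<mu> D}" by blast
  qed (auto simp: Delta_hat_eq[OF D] injectivity_points_add_of_int)
  moreover have "inj_on G injectivity_points"
    by (rule inj_onI) (metis injectivity_pointsD)
  ultimately show ?thesis using x by (simp add: Gamma_hat_inv_def)
qed

text \<open>The point \<open>\<Phi> x\<close> inherits injectivity from \<open>x\<close>, so it is what the partial inverse finds over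
  \<open>G x + \<rho>\<close>.\<close>

lemma Omega_hat_eq:
  assumes D: "minimal_set \<phi> D" and x: "x \<in> injectivity_points"
  shows "Omega_hat \<mu> D \<rho> (G x) = displacement \<Phi> x"
  using Gamma_hat_inv_eq[OF D x] Gamma_hat_inv_eq[OF D lift_mem_injectivity_points[OF x]]
  by (simp add: Omega_hat_def semiconjugacy displacement_def)

lemma Omega_eq:
  assumes "strict_mono G"
  shows "Omega \<mu> \<rho> (G x) = displacement \<Phi> x"
proof -
  have "inv G (G y) = y" for y using assms by (simp add: inv_f_f strict_mono_imp_inj_on)
  then show ?thesis by (simp add: Omega_def displacement_def flip: semiconjugacy)
qed

theorem transitive_displacement_distribution:
  assumes "transitive_on_circle \<phi>" and A: "A \<in> sets borel"
  shows "emeasure (displacement_distribution \<mu> \<Phi>) A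
    = emeasure lborel {x \<in> {0..<1}. Omega \<mu> \<rho> x \<in> A}"
proof -
  have G: "strict_mono G" by (rule transitive_imp_strict_mono) fact
  have inj: "injectivity_points = UNIV"
    using injectivity_points_iff strict_mono_iff_no_plateau G by auto
  have "{x \<in> {0..<1}. Omega \<mu> \<rho> x \<in> A} = G ` {x \<in> {0..<1}. displacement \<Phi> x \<in> A}"
  proof (intro equalityI subsetI)
    fix t assume t: "t \<in> {x \<in> {0..<1}. Omega \<mu> \<rho> x \<in> A}"
    obtain x where x: "G x = t" by (rule attained)
    have "0 \<le> x" "x < 1"
      using t strict_mono_less_eq[OF G, of 0 x] strict_mono_less[OF G, of x 1] x by simp_all
    then show "t \<in> G ` {x \<in> {0..<1}. displacement \<Phi> x \<in> A}"
      using t Omega_eq[OF G, of x] unfolding x by (intro image_eqI[of _ _ x]) (simp_all add: x)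
  next
    fix t assume "t \<in> G ` {x \<in> {0..<1}. displacement \<Phi> x \<in> A}"
    then obtain x where x: "t = G x" "0 \<le> x" "x < 1" "displacement \<Phi> x \<in> A" by auto
    then show "t \<in> {x \<in> {0..<1}. Omega \<mu> \<rho> x \<in> A}"
      using strict_mono_less_eq[OF G, of 0 x] strict_mono_less[OF G, of x 1]
      by (simp add: Omega_eq[OF G])
  qed
  then show ?thesis using displacement_distribution_transport[OF A] by (simp add: inj)
qed

theorem transitive_support:
  assumes "transitive_on_circle \<phi>"
  shows "measure_support (displacement_distribution \<mu> \<Phi>) = displacement \<Phi> ` {0..1}"
    and "displacement \<Phi> ` {0..1} = Omega \<mu> \<rho> ` {0..1}"
proof -
  have G: "strict_mono G" by (rule transitive_imp_strict_mono) fact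
  have growth: "growth_points = UNIV"
  proof -
    have "y \<in> growth_points" for y
      unfolding growth_points_def
      by (intro CollectI allI impI strict_monoD[OF G]) (rule less_trans)
    then show ?thesis by blast
  qed
  have "displacement \<Phi> ` UNIV = displacement \<Phi> ` {0..<1}"
    using displacement_image_periodic[of UNIV] by simp
  moreover have "displacement \<Phi> ` {0..<1} \<subseteq> displacement \<Phi> ` {0..1}" by (rule image_mono) auto
  ultimately have "displacement \<Phi> ` {0..1} = displacement \<Phi> ` {0..<1}" by blast
  then show "measure_support (displacement_distribution \<mu> \<Phi>) = displacement \<Phi> ` {0..1}"
    by (simp add: support_displacement_distribution growth)
  have "G ` {0..1} = {0..1}"
  proof (intro equalityI subsetI)
    fix t :: real assume t: "t \<in> {0..1}"
    obtain x where x: "G x = t" by (rule attained)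
    have "0 \<le> x" "x \<le> 1"
      using t strict_mono_less_eq[OF G, of 0 x] strict_mono_less_eq[OF G, of x 1] x by simp_all
    then show "t \<in> G ` {0..1}" using x by (intro image_eqI[of _ _ x]) simp_all
  qed (use G_bounds in auto)
  then have "Omega \<mu> \<rho> ` {0..1} = Omega \<mu> \<rho> ` G ` {0..1}" by simp
  also have "\<dots> = displacement \<Phi> ` {0..1}" by (simp add: image_image Omega_eq[OF G])
  finally show "displacement \<Phi> ` {0..1} = Omega \<mu> \<rho> ` {0..1}" ..
qed

theorem minimal_displacement_distribution:
  assumes D: "minimal_set \<phi> D" and A: "A \<in> sets borel"
  shows "emeasure (displacement_distribution \<mu> \<Phi>) A
    = emeasure lborel {x \<in> G ` Delta_hat \<mu> D. Omega_hat \<mu> D \<rho> x \<in> A}"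
proof -
  have "{x \<in> G ` Delta_hat \<mu> D. Omega_hat \<mu> D \<rho> x \<in> A}
      = G ` {x \<in> {0..<1} \<inter> injectivity_points. displacement \<Phi> x \<in> A}"
    unfolding Delta_hat_eq[OF D] using Omega_hat_eq[OF D] by (auto intro!: imageI)
  then show ?thesis using displacement_distribution_transport[OF A] by simp
qed

theorem minimal_support:
  assumes D: "minimal_set \<phi> D"
  shows "measure_support (displacement_distribution \<mu> \<Phi>) = displacement \<Phi> ` lift_set D"
proof -
  have "lift_set D = growth_points \<inter> {0..<1}"
    using minimal_set_lift[OF D] by (auto simp: lift_set_def)
  then show ?thesis by (simp add: support_displacement_distribution)
qed

end

section \<open>The displacement distribution\<close>

theorem proposition3p3:
  fixes \<phi> :: "complex \<Rightarrow> complex" and \<Phi> :: "real \<Rightarrow> real"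
    and \<rho> :: real and \<mu> :: "complex measure"
  assumes homeo: "orientation_preserving_homeo \<phi>"
    and rot: "has_rotation_number \<phi> \<rho>" "\<rho> \<in> {0<..<1}" "\<rho> \<notin> \<rat>"
    and lift: "circle_lift \<phi> \<Phi>" "\<Phi> 0 \<in> {0<..<1}"
    and mu: "invariant_probability \<phi> \<mu>" "ergodic_measure \<phi> \<mu>"
  shows
    "(transitive_on_circle \<phi> \<longrightarrow>
        (\<forall>A\<in>sets borel. A \<subseteq> {0..<1} \<longrightarrow>
           emeasure (displacement_distribution \<mu> \<Phi>) A
             = emeasure lborel {x \<in> {0..<1}. Omega \<mu> \<rho> x \<in> A}) \<and>
        measure_support (displacement_distribution \<mu> \<Phi>) = displacement \<Phi> ` {0..1} \<and>
        displacement \<Phi> ` {0..1} = Omega \<mu> \<rho> ` {0..1})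
     \<and>
     (\<not> transitive_on_circle \<phi> \<longrightarrow>
        (\<forall>\<Delta>. minimal_set \<phi> \<Delta> \<longrightarrow>
          (\<forall>A\<in>sets borel. A \<subseteq> {0..<1} \<longrightarrow>
             emeasure (displacement_distribution \<mu> \<Phi>) A
               = emeasure lborel
                   {x \<in> Gamma_lift \<mu> ` Delta_hat \<mu> \<Delta>. Omega_hat \<mu> \<Delta> \<rho> x \<in> A}) \<and>
          measure_support (displacement_distribution \<mu> \<Phi>) = displacement \<Phi> ` lift_set \<Delta>))"
proof -
  note \<Phi>_0 = lift(2)
  interpret invariant_circle_measure \<phi> \<Phi> \<mu>
    by unfold_locales (rule homeo lift(1) mu(1))+
  interpret irrational_semiconjugacy \<phi> \<Phi> \<mu> \<rho>
    by unfold_locales (rule rot(3), rule Gamma_lift_rotation[OF rot(1,2) \<Phi>_0])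
  show ?thesis
    by (intro conjI impI allI ballI transitive_displacement_distribution transitive_support
        minimal_displacement_distribution minimal_support)
qed

end
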